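(* Assume that the function $S$ is either positive on all of $D$ or negative on all of $D$. If $\rho_S>N$ and $\varlimsup_{p\to\infty}O_p(f,D)/N^p=+\infty$, then \[ \dim_B\,\Gamma f=1+\frac{\log\rho_S}{\log N}. \] Otherwise, $\dim_B\,\Gamma f=2$.
   Context: Grid. Let $N\ge 2$ be an integer, and let $x_0<x_1<\cdots<x_N$ and $y_0<y_1<\cdots<y_N$ be real numbers with $x_i-x_{i-1}=(x_N-x_0)/N$ and $y_i-y_{i-1}=(y_N-y_0)/N$ for $1\le i\le N$, and $x_N-x_0=y_N-y_0$. Put $I=[x_0,x_N]$, $J=[y_0,y_N]$, $D=I\times J$, $I_i=[x_{i-1},x_i]$, $J_j=[y_{j-1},y_j]$. For $1\le i\le N$ let $u_i:I\to I_i$ be the affine map with $u_i(x_0)=x_{i-1}$, $u_i(x_N)=x_i$ if $i$ is odd, and $u_i(x_0)=x_i$, $u_i(x_N)=x_{i-1}$ if $i$ is even; let $v_j:J\to J_j$ be the affine map with $v_j(y_0)=y_{j-1}$, $v_j(y_N)=y_j$ if $j$ is odd, and $v_j(y_0)=y_j$, $v_j(y_N)=y_{j-1}$ if $j$ is even. Let $\Sigma=\{1,\dots,N\}\times\{1,\dots,N\}$. For $w=(i,j)\in\Sigma$ let $D_w=I_i\times J_j$ and $L_w:D\to D_w$, $L_w(x,y)=(u_i(x),v_j(y))$. The function $f$. Let $z_{ij}\in\mathbb{R}$ ($0\le i,j\le N$) be given. Let $g,h,S:D\to\mathbb{R}$ be continuous with $g(x_i,y_j)=z_{ij}$ for $i,j\in\{0,N\}$,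 $h(x_i,y_j)=z_{ij}$ for all $0\le i,j\le N$, and $|S(x,y)|<1$ for all $(x,y)\in D$. Define $q:D\to\mathbb{R}$ by $q(x,y)=h(x,y)-S(x,y)\,g(L_w^{-1}(x,y))$ for $(x,y)\in D_w$, $w\in\Sigma$ (this is well defined and continuous). For $w=(i,j)\in\Sigma$ let $F_w(x,y,z)=S(L_w(x,y))\,z+q(L_w(x,y))$ and $\Psi_w(x,y,z)=(u_i(x),v_j(y),F_w(x,y,z))$ on $D\times\mathbb{R}$. It is known that there is a unique continuous $f:D\to\mathbb{R}$ with $f(x_i,y_j)=z_{ij}$ for all $0\le i,j\le N$ whose graph $\Gamma f=\{(x,y,f(x,y)):(x,y)\in D\}$ satisfies $\Gamma f=\bigcup_{w\in\Sigma}\Psi_w(\Gamma f)$; thus $f(x,y)=S(x,y)f(L_w^{-1}(x,y))+q(x,y)$ for $(x,y)\in D_w$. $\Gamma f$ is called a generalized affine fractal interpolation surface and $S$ its vertical scaling function. Assume that $S$ and $q$ are Lipschitz on $D$: there are $\lambda_S,\lambda_q>0$ with $|S(t_1)-S(t_2)|\le\lambda_S|t_1-t_2|$ and $|q(t_1)-q(t_2)|\le\lambda_q|t_1-t_2|$ for all $t_1,t_2\in D$. Words. For $n\ge1$, $\Sigma^n$ is the set of words $\mathbf w=w_1\cdots w_n$ with letters in $\Sigma$; $\Sigma^0$ consists of the empty word. For $\mathbf w=w_1\cdots w_n\in\Sigma^n$ put $\sigma(\mathbf w)=w_2\cdots w_n\in\Sigma^{n-1}$, $L_{\mathbf w}=L_{w_1}\circ\cdots\circ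 L_{w_n}$, $D_{\mathbf w}=L_{\mathbf w}(D)$. Juxtaposition denotes concatenation. Oscillation sums. For $E\subset D$, $O(f,E)=\sup\{f(\mathbf x')-f(\mathbf x''):\mathbf x',\mathbf x''\in E\}$, and $O_p(f,D)=\sum_{\mathbf w\in\Sigma^p}O(f,D_{\mathbf w})$ for $p\ge1$. Vertical scaling matrices and $\rho_S$. For a word $\mathbf w$ put $\overline s_{\mathbf w}=\sup_{t\in D_{\mathbf w}}|S(t)|$, $\underline s_{\mathbf w}=\inf_{t\in D_{\mathbf w}}|S(t)|$. For $n\ge1$, $\overline M_n$ is the $\Sigma^n\times\Sigma^n$ matrix with $(\overline M_n)_{\mathbf i,\mathbf j}=\overline s_{\mathbf i j_n}$ if $\sigma(\mathbf i)=j_1\cdots j_{n-1}$ and $0$ otherwise, where $\mathbf i=i_1\cdots i_n$, $\mathbf j=j_1\cdots j_n$; $\underline M_n$ is defined in the same way with $\underline s_{\mathbf i j_n}$ in place of $\overline s_{\mathbf i j_n}$. Let $\rho(A)$ denote the spectral radius of a square matrix $A$. It is known that $\rho(\underline M_n)\le\rho(\underline M_{n+1})\le\rho(\overline M_{n+1})\le\rho(\overline M_n)$ for all $n$, so the limits $\rho_*=\lim_{n\to\infty}\rho(\underline M_n)$ and $\rho^*=\lim_{n\to\infty}\rho(\overline M_n)$ exist, and that $\rho_*=\rho^*$ when $S$ is positive on all of $D$ or negative on all of $D$; in that case the common value is denoted $\rho_S$. Box dimension. For $\varepsilon>0$ and bounded $E\subset\mathbb{R}^d$, let $\mathcal N_E(\varepsilon)$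 be the number of cubes $\prod_{i=1}^d[n_i\varepsilon,(n_i+1)\varepsilon]$, $n_i\in\mathbb{Z}$, intersecting $E$; $\overline{\dim}_B E$ and $\underline{\dim}_B E$ are the $\varlimsup$ and $\varliminf$ as $\varepsilon\to0$ of $\frac{\log\mathcal N_E(\varepsilon)}{\log(1/\varepsilon)}$. The equality $\dim_B E=d_0$ means that both are equal to $d_0$. *)

theory Defs
  imports "HOL-Analysis.Analysis" "Jordan_Normal_Form.Spectral_Radius"
begin

definition grid_cubes :: "real \<Rightarrow> 'a::euclidean_space set \<Rightarrow> 'a set set" where
  "grid_cubes \<epsilon> E =
     {cbox (\<epsilon> *\<^sub>R n) (\<epsilon> *\<^sub>R (n + One)) | n.
        (\<forall>b\<in>Basis. n \<bullet> b \<in> \<int>) \<and> cbox (\<epsilon> *\<^sub>R n) (\<epsilon> *\<^sub>R (n + One)) \<inter> E \<noteq> {}}"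

definition upper_box_dim :: "'a::euclidean_space set \<Rightarrow> ereal" where
  "upper_box_dim E =
     Limsup (at_right 0) (\<lambda>\<epsilon>. ereal (ln (real (card (grid_cubes \<epsilon> E))) / ln (1 / \<epsilon>)))"

definition lower_box_dim :: "'a::euclidean_space set \<Rightarrow> ereal" where
  "lower_box_dim E =
     Liminf (at_right 0) (\<lambda>\<epsilon>. ereal (ln (real (card (grid_cubes \<epsilon> E))) / ln (1 / \<epsilon>)))"

definition has_box_dim :: "'a::euclidean_space set \<Rightarrow> real \<Rightarrow> bool" where
  "has_box_dim E d \<longleftrightarrow> upper_box_dim E = ereal d \<and> lower_box_dim E = ereal d"

definition uniform_partition :: "nat \<Rightarrow> (nat \<Rightarrow> real) \<Rightarrow> bool" where
  "uniform_partition N x \<longleftrightarrow>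
     (\<forall>i\<in>{1..N}. x (i - 1) < x i \<and> x i - x (i - 1) = (x N - x 0) / real N)"

definition rect :: "nat \<Rightarrow> (nat \<Rightarrow> real) \<Rightarrow> (nat \<Rightarrow> real) \<Rightarrow> (real \<times> real) set" where
  "rect N x y = {x 0..x N} \<times> {y 0..y N}"

text \<open>The affine map sending \<open>a\<close> to \<open>c\<close> and \<open>b\<close> to \<open>d\<close> (for \<open>a \<noteq> b\<close>).\<close>

definition affine_through :: "real \<Rightarrow> real \<Rightarrow> real \<Rightarrow> real \<Rightarrow> real \<Rightarrow> real" where
  "affine_through a b c d t = c + (d - c) * ((t - a) / (b - a))"

text \<open>This is \<open>u\<^sub>i\<close> for the \<open>x\<close>-partition and \<open>v\<^sub>j\<close> for the \<open>y\<close>-partition; the orientation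
  alternates with the parity of the index.\<close>

definition folding_map :: "nat \<Rightarrow> (nat \<Rightarrow> real) \<Rightarrow> nat \<Rightarrow> real \<Rightarrow> real" where
  "folding_map N x i =
     (if odd i then affine_through (x 0) (x N) (x (i - 1)) (x i)
      else affine_through (x 0) (x N) (x i) (x (i - 1)))"

type_synonym letter = "nat \<times> nat"
type_synonym word = "letter list"

definition letters :: "nat \<Rightarrow> letter set" where
  "letters N = {1..N} \<times> {1..N}"

definition words :: "nat \<Rightarrow> nat \<Rightarrow> word set" where
  "words N n = {w. length w = n \<and> set w \<subseteq> letters N}"

definition cell :: "(nat \<Rightarrow> real) \<Rightarrow> (nat \<Rightarrow> real) \<Rightarrow> letter \<Rightarrow> (real \<times> real) set" where
  "cell x y = (\<lambda>(i, j). {x (i - 1)..x i} \<times> {y (j - 1)..y j})"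

definition L_map ::
    "nat \<Rightarrow> (nat \<Rightarrow> real) \<Rightarrow> (nat \<Rightarrow> real) \<Rightarrow> letter \<Rightarrow> real \<times> real \<Rightarrow> real \<times> real" where
  "L_map N x y = (\<lambda>(i, j) (a, b). (folding_map N x i a, folding_map N y j b))"

text \<open>\<open>L\<^sub>w = L\<^bsub>w\<^sub>1\<^esub> \<circ> \<dots> \<circ> L\<^bsub>w\<^sub>n\<^esub>\<close>: the first letter is applied last.\<close>

definition L_word ::
    "nat \<Rightarrow> (nat \<Rightarrow> real) \<Rightarrow> (nat \<Rightarrow> real) \<Rightarrow> word \<Rightarrow> real \<times> real \<Rightarrow> real \<times> real" where
  "L_word N x y w = foldr (\<lambda>l F. L_map N x y l \<circ> F) w id"

definition D_word :: "nat \<Rightarrow> (nat \<Rightarrow> real) \<Rightarrow> (nat \<Rightarrow> real) \<Rightarrow> word \<Rightarrow> (real \<times> real) set" where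
  "D_word N x y w = L_word N x y w ` rect N x y"

definition F_map ::
    "nat \<Rightarrow> (nat \<Rightarrow> real) \<Rightarrow> (nat \<Rightarrow> real) \<Rightarrow> (real \<times> real \<Rightarrow> real) \<Rightarrow> (real \<times> real \<Rightarrow> real) \<Rightarrow>
     letter \<Rightarrow> real \<Rightarrow> real \<Rightarrow> real \<Rightarrow> real" where
  "F_map N x y S q w a b c = S (L_map N x y w (a, b)) * c + q (L_map N x y w (a, b))"

definition Psi_map ::
    "nat \<Rightarrow> (nat \<Rightarrow> real) \<Rightarrow> (nat \<Rightarrow> real) \<Rightarrow> (real \<times> real \<Rightarrow> real) \<Rightarrow> (real \<times> real \<Rightarrow> real) \<Rightarrow>
     letter \<Rightarrow> real \<times> real \<times> real \<Rightarrow> real \<times> real \<times> real" where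
  "Psi_map N x y S q = (\<lambda>(i, j) (a, b, c).
     (folding_map N x i a, folding_map N y j b, F_map N x y S q (i, j) a b c))"

definition surface_graph ::
    "(real \<times> real) set \<Rightarrow> (real \<times> real \<Rightarrow> real) \<Rightarrow> (real \<times> real \<times> real) set" where
  "surface_graph D f = {(a, b, f (a, b)) | a b. (a, b) \<in> D}"

definition osc :: "('a \<Rightarrow> real) \<Rightarrow> 'a set \<Rightarrow> real" where
  "osc f E = Sup {f t' - f t'' | t' t''. t' \<in> E \<and> t'' \<in> E}"

definition osc_sum ::
    "nat \<Rightarrow> (nat \<Rightarrow> real) \<Rightarrow> (nat \<Rightarrow> real) \<Rightarrow> (real \<times> real \<Rightarrow> real) \<Rightarrow> nat \<Rightarrow> real" where
  "osc_sum N x y f p = (\<Sum>w\<in>words N p. osc f (D_word N x y w))"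

definition s_upper ::
    "nat \<Rightarrow> (nat \<Rightarrow> real) \<Rightarrow> (nat \<Rightarrow> real) \<Rightarrow> (real \<times> real \<Rightarrow> real) \<Rightarrow> word \<Rightarrow> real" where
  "s_upper N x y S w = (SUP t\<in>D_word N x y w. \<bar>S t\<bar>)"

definition s_lower ::
    "nat \<Rightarrow> (nat \<Rightarrow> real) \<Rightarrow> (nat \<Rightarrow> real) \<Rightarrow> (real \<times> real \<Rightarrow> real) \<Rightarrow> word \<Rightarrow> real" where
  "s_lower N x y S w = (INF t\<in>D_word N x y w. \<bar>S t\<bar>)"

text \<open>Matrices indexed by words of length \<open>n\<close> become matrices indexed by numbers via an
  enumeration of these words; the spectral radius does not depend on the enumeration.\<close>

definition word_enum :: "nat \<Rightarrow> nat \<Rightarrow> word list" where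
  "word_enum N n = List.n_lists n (List.product [1..<Suc N] [1..<Suc N])"

lemma set_word_enum: "set (word_enum N n) = words N n"
  by (auto simp: word_enum_def words_def letters_def set_n_lists)

lemma distinct_word_enum: "distinct (word_enum N n)"
  unfolding word_enum_def by (intro distinct_n_lists distinct_product distinct_upt)

text \<open>The matrix whose entry at the words \<open>i\<close>, \<open>j\<close> of length \<open>n \<ge> 1\<close> is \<open>s (i j\<^sub>n)\<close> if
  \<open>i\<^sub>2 \<dots> i\<^sub>n = j\<^sub>1 \<dots> j\<^bsub>n-1\<^esub>\<close>, and 0 otherwise. The entries are real; they are regarded
  as complex numbers because the spectral radius is that of a complex matrix.\<close>

definition word_matrix :: "nat \<Rightarrow> (word \<Rightarrow> real) \<Rightarrow> nat \<Rightarrow> complex Matrix.mat" where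
  "word_matrix N s n =
     (let ws = word_enum N n in
      Matrix.mat (length ws) (length ws)
        (\<lambda>(k, l). if tl (ws ! k) = butlast (ws ! l)
                  then complex_of_real (s (ws ! k @ [last (ws ! l)])) else 0))"

definition M_upper ::
    "nat \<Rightarrow> (nat \<Rightarrow> real) \<Rightarrow> (nat \<Rightarrow> real) \<Rightarrow> (real \<times> real \<Rightarrow> real) \<Rightarrow> nat \<Rightarrow> complex Matrix.mat" where
  "M_upper N x y S n = word_matrix N (s_upper N x y S) n"

definition M_lower ::
    "nat \<Rightarrow> (nat \<Rightarrow> real) \<Rightarrow> (nat \<Rightarrow> real) \<Rightarrow> (real \<times> real \<Rightarrow> real) \<Rightarrow> nat \<Rightarrow> complex Matrix.mat" where
  "M_lower N x y S n = word_matrix N (s_lower N x y S) n"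

text \<open>The common limit of the two sequences of spectral radii. It exists if \<open>S\<close> has constant
  sign on the rectangle; otherwise the value may be unspecified.\<close>

definition rho_S ::
    "nat \<Rightarrow> (nat \<Rightarrow> real) \<Rightarrow> (nat \<Rightarrow> real) \<Rightarrow> (real \<times> real \<Rightarrow> real) \<Rightarrow> real" where
  "rho_S N x y S = (THE r.
     (\<lambda>n. spectral_radius (M_lower N x y S n)) \<longlonglongrightarrow> r \<and>
     (\<lambda>n. spectral_radius (M_upper N x y S n)) \<longlonglongrightarrow> r)"

end

theory Submission
  imports Defs
begin

text \<open>
  Two facts carry the proof. First, the number of \<open>\<epsilon>\<close>-cubes that meet the graph is comparable to
  \<open>N ^ p * O p + N ^ (2 * p)\<close>, where \<open>O p\<close> is the oscillation sum \<open>osc_sum\<close> of level \<open>p\<close> and \<open>N ^ p\<close> is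
  comparable to \<open>1 / \<epsilon>\<close> (\<open>card_grid_cubes_upper\<close>, \<open>card_grid_cubes_lower\<close>). The dimension is therefore
  decided by the exponential growth of \<open>O p\<close>, with \<open>N\<close> as threshold: growth slower than every
  \<open>\<tau> ^ p\<close> with \<open>\<tau> > N\<close> gives dimension 2, and growth like \<open>r ^ p\<close> with \<open>r > N\<close> gives
  \<open>1 + log N r\<close>.

  Second, the functional equation of \<open>f\<close> and the Lipschitz conditions show that prefixing a letter to a
  word multiplies the oscillation over its cylinder by the supremum of \<open>\<bar>S\<bar>\<close> over the new cylinder, up
  to an error of the order of the diameter (\<open>oscillation_recursion\<close>). Iterating this along a
  word \<open>u\<close> produces a product of such suprema. Since \<open>\<bar>S\<bar>\<close> is Lipschitz and bounded away from 0, the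
  product depends on the word that follows \<open>u\<close> only up to a bounded factor (\<open>bounded_distortion\<close>). Summing
  over words leads to the scalar recursion that \<open>O (k + p)\<close> lies, up to an error of order \<open>N ^ p\<close>,
  between \<open>exp (- K) * Z k * O p\<close> and \<open>Z k * O p\<close>, where \<open>Z k\<close> is the sum of the products over all words of
  length \<open>k\<close> (\<open>cylinder_sum\<close>). The sequence \<open>Z\<close> is submultiplicative; let \<open>r\<close> be its growth rate. Then
  \<open>O p\<close> is at most of the order of \<open>\<tau> ^ p\<close> for every \<open>\<tau>\<close> above both \<open>r\<close> and \<open>N\<close>. If \<open>r > N\<close>, it is at least
  of the order of \<open>\<tau> ^ p\<close> for every \<open>\<tau>\<close> between \<open>N\<close> and \<open>r\<close>, provided that \<open>O p / N ^ p\<close> is once large enough to dominate the accumulated errors; this is where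
  the unbounded quotient enters.

  It remains to identify \<open>r\<close> with the limit of the spectral radii (\<open>rho_S_eq\<close>). By Gelfand's formula the
  spectral radius of a nonnegative matrix is the exponential growth rate of the row sums of its
  powers. For the scaling matrices of level \<open>n\<close> these row sums are sums of products in which each factor
  is computed from \<open>n + 1\<close> consecutive letters instead of from the whole remaining word. The two kinds of
  factors differ by at most \<open>1 + K / N ^ (n + 1)\<close>, which tends to 1. This comparison of growth rates takes
  the place of Perron eigenvectors throughout.
\<close>

section \<open>Spectral radius and row sums of matrix powers\<close>

lemma le_if_powers_le:
  fixes a b C :: real
  assumes "0 < a" "0 < b" "\<And>k::nat. a ^ k \<le> C * b ^ k"
  shows "a \<le> b"
proof (rule ccontr)
  assume "\<not> a \<le> b"
  then have "1 < a / b" using assms by simp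
  then obtain k where "C < (a / b) ^ k" using real_arch_pow by blast
  then have "C * b ^ k < a ^ k" using assms(2) by (simp add: power_divide pos_less_divide_eq)
  with assms(3)[of k] show False by simp
qed

text \<open>
  Here \<open>b k i\<close> is the \<open>i\<close>-th row sum of the \<open>k\<close>-th power of the nonnegative matrix \<open>m\<close>. If \<open>v\<close> is
  an eigenvector for an eigenvalue \<open>e\<close> of maximal modulus, then applying the matrix \<open>k\<close> times gives
  \<open>\<bar>e\<bar> ^ k * \<bar>v i\<bar> \<le> b k i * max \<bar>v\<bar>\<close>; at a coordinate where \<open>\<bar>v\<bar>\<close> is maximal this bounds
  \<open>\<bar>e\<bar> ^ k\<close> by a single row sum.
\<close>
lemma spectral_radius_power_le_row_sums:
  fixes m b :: "nat \<Rightarrow> nat \<Rightarrow> real"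
  assumes A: "A \<in> carrier_mat d d" and d: "0 < d"
    and entry: "\<And>i j. i < d \<Longrightarrow> j < d \<Longrightarrow> A $$ (i, j) = complex_of_real (m i j)"
    and nonneg: "\<And>i j. i < d \<Longrightarrow> j < d \<Longrightarrow> 0 \<le> m i j"
    and b0: "\<And>i. i < d \<Longrightarrow> b 0 i = 1"
    and bSuc: "\<And>k i. i < d \<Longrightarrow> b (Suc k) i = (\<Sum>j<d. m i j * b k j)"
  shows "spectral_radius A ^ k \<le> (\<Sum>i<d. b k i)"
proof -
  obtain e where "e \<in> spectrum A" and e: "spectral_radius A = norm e"
    using spectral_radius_mem_max(1)[OF A d] by auto
  then obtain v where v: "v \<in> carrier_vec d" "v \<noteq> 0\<^sub>v d" "A *\<^sub>v v = e \<cdot>\<^sub>v v"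
    using A by (auto simp: spectrum_def eigenvalue_def eigenvector_def)
  have eig: "e * vec_index v i = (\<Sum>j<d. m i j * vec_index v j)" if "i < d" for i
  proof -
    have "e * vec_index v i = vec_index (A *\<^sub>v v) i" using v that by simp
    also have "\<dots> = (\<Sum>j<d. m i j * vec_index v j)"
      using A v(1) that entry by (auto simp: scalar_prod_def lessThan_atLeast0 intro!: sum.cong)
    finally show ?thesis .
  qed
  define V where "V = Max ((\<lambda>i. norm (vec_index v i)) ` {..<d})"
  have ne: "(\<lambda>i. norm (vec_index v i)) ` {..<d} \<noteq> {}" using d by auto
  have V_ge: "norm (vec_index v i) \<le> V" if "i < d" for i
    using that by (auto simp: V_def intro!: Max_ge)
  obtain i0 where i0: "i0 < d" "norm (vec_index v i0) = V"
    using Max_in[OF _ ne] by (auto simp: V_def)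
  have "\<exists>i<d. vec_index v i \<noteq> 0"
    using v(1,2) by (metis carrier_vecD eq_vecI index_zero_vec(1) index_zero_vec(2))
  then have V: "0 < V" using V_ge by (meson order_less_le_trans zero_less_norm_iff)
  have b_nonneg: "0 \<le> b k i" if "i < d" for k i
    using that by (induction k arbitrary: i) (auto simp: b0 bSuc nonneg intro!: sum_nonneg mult_nonneg_nonneg)
  have pow: "norm e ^ k * norm (vec_index v i) \<le> b k i * V" if "i < d" for i
    using that
  proof (induction k arbitrary: i)
    case 0 then show ?case using V_ge by (simp add: b0)
  next
    case (Suc k)
    have "norm e ^ Suc k * norm (vec_index v i) = norm e ^ k * norm (e * vec_index v i)"
      by (simp add: norm_mult)
    also have "\<dots> \<le> norm e ^ k * (\<Sum>j<d. m i j * norm (vec_index v j))"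
      unfolding eig[OF Suc.prems] using Suc.prems nonneg
      by (intro mult_left_mono sum_norm_le) (auto simp: norm_mult)
    also have "\<dots> = (\<Sum>j<d. m i j * (norm e ^ k * norm (vec_index v j)))"
      by (simp add: sum_distrib_left mult_ac)
    also have "\<dots> \<le> (\<Sum>j<d. m i j * (b k j * V))"
      using Suc by (intro sum_mono mult_left_mono nonneg) auto
    also have "\<dots> = b (Suc k) i * V"
      by (simp add: bSuc[OF Suc.prems] sum_distrib_left sum_distrib_right mult_ac)
    finally show ?case .
  qed
  have "norm e ^ k \<le> b k i0" using pow[OF i0(1)] i0(2) V by simp
  also have "\<dots> \<le> (\<Sum>i<d. b k i)"
    using i0(1) b_nonneg by (intro member_le_sum) auto
  finally show ?thesis by (simp add: e)
qed

text \<open>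
  The converse half of Gelfand's formula: after division by \<open>\<tau>\<close> the spectral radius drops below 1, so
  by the Jordan normal form the powers of the scaled matrix have uniformly bounded entries.
\<close>
lemma row_sums_le_power_above_spectral_radius:
  fixes m b :: "nat \<Rightarrow> nat \<Rightarrow> real"
  assumes A: "A \<in> carrier_mat d d" and d: "0 < d"
    and entry: "\<And>i j. i < d \<Longrightarrow> j < d \<Longrightarrow> A $$ (i, j) = complex_of_real (m i j)"
    and b0: "\<And>i. i < d \<Longrightarrow> b 0 i = 1"
    and bSuc: "\<And>k i. i < d \<Longrightarrow> b (Suc k) i = (\<Sum>j<d. m i j * b k j)"
    and \<tau>: "spectral_radius A < \<tau>"
  shows "\<exists>C. \<forall>k. (\<Sum>i<d. b k i) \<le> C * \<tau> ^ k"
proof -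
  have "0 \<le> spectral_radius A" using spectral_radius_mem_max(1)[OF A d] by auto
  with \<tau> have \<tau>0: "0 < \<tau>" by simp
  define A' where "A' = complex_of_real (1 / \<tau>) \<cdot>\<^sub>m A"
  have A': "A' \<in> carrier_mat d d" using A by (simp add: A'_def)
  have "spectral_radius A' < 1"
  proof -
    obtain e where "e \<in> spectrum A'" and e: "spectral_radius A' = norm e"
      using spectral_radius_mem_max(1)[OF A' d] by auto
    then obtain v where v: "v \<in> carrier_vec d" "v \<noteq> 0\<^sub>v d" "A' *\<^sub>v v = e \<cdot>\<^sub>v v"
      using A' by (auto simp: spectrum_def eigenvalue_def eigenvector_def)
    have "A *\<^sub>v v = (\<tau> * e) \<cdot>\<^sub>v v"
    proof (rule eq_vecI)
      fix i assume "i < dim_vec ((\<tau> * e) \<cdot>\<^sub>v v)"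
      then have i: "i < d" using v(1) by simp
      have "vec_index (A' *\<^sub>v v) i = vec_index (A *\<^sub>v v) i / \<tau>"
        using A v(1) i by (simp add: A'_def scalar_prod_def sum_divide_distrib)
      then show "vec_index (A *\<^sub>v v) i = vec_index ((\<tau> * e) \<cdot>\<^sub>v v) i"
        using v i \<tau>0 by (simp add: field_simps)
    qed (use A v in auto)
    then have "\<tau> * e \<in> spectrum A"
      using A v by (auto simp: spectrum_def eigenvalue_def eigenvector_def)
    then have "norm (\<tau> * e) \<le> spectral_radius A"
      by (intro spectral_radius_mem_max(2)[OF A d]) auto
    also note \<tau>
    finally show ?thesis using \<tau>0 by (simp add: e norm_mult)
  qed
  from spectral_radius_jnf_norm_bound_less_1_upper_triangular[OF A' this]
  obtain c where c: "\<And>k. norm_bound (A' ^\<^sub>m k) c" by auto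
  define v where "v k = Matrix.vec d (\<lambda>i. complex_of_real (b k i / \<tau> ^ k))" for k
  have v: "v k \<in> carrier_vec d" for k by (simp add: v_def)
  have step: "A' *\<^sub>v v k = v (Suc k)" for k
    using A \<tau>0 entry
    by (intro eq_vecI) (auto simp: v_def A'_def scalar_prod_def bSuc lessThan_atLeast0
        sum_divide_distrib intro!: sum.cong)
  have steps: "A' ^\<^sub>m k *\<^sub>v v l = v (l + k)" for k l
  proof (induction k arbitrary: l)
    case 0 then show ?case using A' v by simp
  next
    case (Suc k)
    have "A' ^\<^sub>m Suc k *\<^sub>v v l = A' ^\<^sub>m k *\<^sub>v (A' *\<^sub>v v l)"
      using A' v[of l] by (simp add: assoc_mult_mat_vec[of _ d d _ d])
    then show ?case by (simp add: step Suc)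
  qed
  have "(\<Sum>i<d. b k i) \<le> (real d * (real d * c)) * \<tau> ^ k" for k
  proof -
    have "b k i \<le> real d * c * \<tau> ^ k" if i: "i < d" for i
    proof -
      have Ak: "A' ^\<^sub>m k \<in> carrier_mat d d" using A' by simp
      have "b k i / \<tau> ^ k \<le> norm (vec_index (v k) i)" using i by (simp only: v_def index_vec norm_of_real abs_ge_self)
      also have "vec_index (v k) i = vec_index (A' ^\<^sub>m k *\<^sub>v v 0) i" by (simp add: steps)
      also have "\<dots> = (\<Sum>j<d. (A' ^\<^sub>m k) $$ (i, j))"
        using i A' Ak b0 by (subst index_mult_mat_vec) (auto simp: scalar_prod_def v_def lessThan_atLeast0 intro!: sum.cong)
      also have "norm \<dots> \<le> (\<Sum>j<d. c)"
        using i A' c[of k] by (intro sum_norm_le) (auto simp: norm_bound_def)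
      finally show ?thesis using \<tau>0 by (simp add: pos_divide_le_eq)
    qed
    then have "(\<Sum>i<d. b k i) \<le> (\<Sum>i<d. real d * c * \<tau> ^ k)" by (intro sum_mono) auto
    then show ?thesis by simp
  qed
  then show ?thesis by blast
qed

section \<open>Words and word matrices\<close>

lemma finite_words [simp]: "finite (words N n)"
  by (metis set_word_enum List.finite_set)

lemma finite_letters [simp]: "finite (letters N)"
  by (simp add: letters_def)

lemma card_letters [simp]: "card (letters N) = N ^ 2"
  by (simp add: letters_def power2_eq_square)

lemma words_0 [simp]: "words N 0 = {[]}"
  by (auto simp: words_def)

lemma card_words: "card (words N n) = N ^ (2 * n)"
proof -
  have "words N n = {w. set w \<subseteq> letters N \<and> length w = n}" by (auto simp: words_def)
  then show ?thesis by (simp add: card_lists_length_eq power_mult)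
qed

lemma sum_words_add:
  "(\<Sum>w\<in>words N (j + k). F w) = (\<Sum>u\<in>words N j. \<Sum>v\<in>words N k. F (u @ v))"
proof -
  have "bij_betw (\<lambda>(u, v). u @ v) (words N j \<times> words N k) (words N (j + k))"
    unfolding bij_betw_def
  proof
    show "inj_on (\<lambda>(u, v). u @ v) (words N j \<times> words N k)"
      by (auto simp: inj_on_def words_def)
    show "(\<lambda>(u, v). u @ v) ` (words N j \<times> words N k) = words N (j + k)"
    proof (intro subset_antisym subsetI)
      fix w assume "w \<in> words N (j + k)"
      then have "w = (\<lambda>(u, v). u @ v) (take j w, drop j w)"
        "(take j w, drop j w) \<in> words N j \<times> words N k"
        by (auto simp: words_def dest: in_set_takeD in_set_dropD)
      then show "w \<in> (\<lambda>(u, v). u @ v) ` (words N j \<times> words N k)" by (rule image_eqI)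
    qed (auto simp: words_def)
  qed
  from sum.reindex_bij_betw[OF this, of F] show ?thesis
    by (simp add: sum.cartesian_product case_prod_unfold)
qed

lemma sum_words_Suc:
  "(\<Sum>w\<in>words N (Suc k). F w) = (\<Sum>a\<in>letters N. \<Sum>v\<in>words N k. F (a # v))"
proof -
  have "words N 1 = (\<lambda>a. [a]) ` letters N"
    by (auto simp: words_def length_Suc_conv)
  then show ?thesis
    using sum_words_add[of F N 1 k] by (simp add: sum.reindex inj_on_def)
qed

text \<open>
  The row sum at the word \<open>w\<close> of the \<open>k\<close>-th power of the word matrix of \<open>s\<close>: in that matrix a
  nonzero entry leads from \<open>w\<close> to \<open>tl w @ [a]\<close> for a letter \<open>a\<close>.
\<close>
primrec word_row_sum :: "nat \<Rightarrow> (word \<Rightarrow> real) \<Rightarrow> nat \<Rightarrow> word \<Rightarrow> real" where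
  "word_row_sum N s 0 w = 1"
| "word_row_sum N s (Suc k) w =
     (\<Sum>a\<in>letters N. s (w @ [a]) * word_row_sum N s k (tl w @ [a]))"

lemma
  assumes n: "0 < n" and N: "0 < N" and nonneg: "\<And>w. w \<in> words N (Suc n) \<Longrightarrow> 0 \<le> s w"
  shows spectral_radius_word_matrix_power_le:
      "spectral_radius (word_matrix N s n) ^ k \<le> (\<Sum>w\<in>words N n. word_row_sum N s k w)"
    and spectral_radius_word_matrix_nonneg: "0 \<le> spectral_radius (word_matrix N s n)"
    and word_row_sum_le_power:
      "spectral_radius (word_matrix N s n) < \<tau> \<Longrightarrow>
       \<exists>C. \<forall>k. (\<Sum>w\<in>words N n. word_row_sum N s k w) \<le> C * \<tau> ^ k"
proof -
  define ws where "ws = word_enum N n"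
  define d where "d = length ws"
  define m where "m i j = (if tl (ws ! i) = butlast (ws ! j) then s (ws ! i @ [last (ws ! j)]) else 0)" for i j
  define b where "b k i = word_row_sum N s k (ws ! i)" for k i
  have bij: "bij_betw ((!) ws) {..<d} (words N n)"
    using bij_betw_nth[OF distinct_word_enum refl set_word_enum[symmetric]]
    by (simp add: ws_def d_def)
  have sum_ws: "(\<Sum>i<d. F (ws ! i)) = (\<Sum>w\<in>words N n. F w)" for F :: "word \<Rightarrow> real"
    using sum.reindex_bij_betw[OF bij] .
  have mem: "ws ! i \<in> words N n" if "i < d" for i
    using that bij by (auto simp: bij_betw_def)
  have A: "word_matrix N s n \<in> carrier_mat d d"
    by (simp add: word_matrix_def Let_def d_def ws_def)
  have "d = card (words N n)" using bij_betw_same_card[OF bij] by simp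
  then have d: "0 < d" using N by (simp add: card_words)
  have entry: "word_matrix N s n $$ (i, j) = complex_of_real (m i j)" if "i < d" "j < d" for i j
    using that by (simp add: word_matrix_def Let_def d_def ws_def m_def)
  have m: "0 \<le> m i j" if "i < d" "j < d" for i j
  proof -
    have "ws ! j \<noteq> []" using mem[OF that(2)] n by (auto simp: words_def)
    then have "last (ws ! j) \<in> letters N" using mem[OF that(2)] by (auto simp: words_def)
    then show ?thesis using mem[OF that(1)] by (auto simp: m_def words_def intro!: nonneg)
  qed
  have b0: "b 0 i = 1" for i by (simp add: b_def)
  have bSuc: "b (Suc k) i = (\<Sum>j<d. m i j * b k j)" if i: "i < d" for k i
  proof -
    define w where "w = ws ! i"
    have w: "w \<in> words N n" "w \<noteq> []" using mem[OF i] n by (auto simp: w_def words_def)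
    define V where "V = {v \<in> words N n. butlast v = tl w}"
    have "(\<Sum>j<d. m i j * b k j) =
      (\<Sum>v\<in>words N n. (if tl w = butlast v then s (w @ [last v]) else 0) * word_row_sum N s k v)"
      unfolding m_def b_def w_def[symmetric] by (rule sum_ws)
    also have "\<dots> = (\<Sum>v\<in>V. s (w @ [last v]) * word_row_sum N s k v)"
      unfolding V_def by (intro sum.mono_neutral_cong_right) auto
    also have "V = (\<lambda>a. tl w @ [a]) ` letters N"
    proof (intro subset_antisym subsetI)
      fix v assume "v \<in> V"
      then have v: "v \<in> words N n" "butlast v = tl w" by (auto simp: V_def)
      then have "v \<noteq> []" using n by (auto simp: words_def)
      then have "v = tl w @ [last v]" "last v \<in> letters N"
        using v by (auto simp: words_def simp flip: v(2))
      then show "v \<in> (\<lambda>a. tl w @ [a]) ` letters N" by blast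
    next
      fix v assume "v \<in> (\<lambda>a. tl w @ [a]) ` letters N"
      then show "v \<in> V" using w by (auto simp: V_def words_def dest: list.set_sel(2))
    qed
    also have "(\<Sum>v\<in>\<dots>. s (w @ [last v]) * word_row_sum N s k v) = word_row_sum N s (Suc k) w"
      by (subst sum.reindex) (auto simp: inj_on_def)
    finally show ?thesis by (simp add: b_def w_def)
  qed
  have sum_b: "(\<Sum>i<d. b k i) = (\<Sum>w\<in>words N n. word_row_sum N s k w)" for k
    unfolding b_def by (rule sum_ws)
  show "spectral_radius (word_matrix N s n) ^ k \<le> (\<Sum>w\<in>words N n. word_row_sum N s k w)"
    using spectral_radius_power_le_row_sums[OF A d entry m b0 bSuc, of k] by (simp add: sum_b)
  show "0 \<le> spectral_radius (word_matrix N s n)"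
    using spectral_radius_mem_max(1)[OF A d] by auto
  show "\<exists>C. \<forall>k. (\<Sum>w\<in>words N n. word_row_sum N s k w) \<le> C * \<tau> ^ k"
    if "spectral_radius (word_matrix N s n) < \<tau>"
    using row_sums_le_power_above_spectral_radius[OF A d entry b0 bSuc that] by (simp add: sum_b)
qed

section \<open>Weights of bounded distortion on words\<close>

text \<open>
  If the weight of a word is \<open>\<bar>S\<bar>\<close> on its cylinder, then this is the factor by which differences of
  function values get multiplied when the maps indexed by the letters of the word are applied one
  after the other.
\<close>
primrec suffix_prod :: "(word \<Rightarrow> real) \<Rightarrow> word \<Rightarrow> real" where
  "suffix_prod \<sigma> [] = 1"
| "suffix_prod \<sigma> (a # w) = \<sigma> (a # w) * suffix_prod \<sigma> w"

lemma suffix_prod_append: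
  "suffix_prod \<sigma> (u @ v) = suffix_prod (\<lambda>u'. \<sigma> (u' @ v)) u * suffix_prod \<sigma> v"
  by (induction u) auto

text \<open>
  The abstract properties of the upper vertical scaling factors: they lie between a positive constant
  and 1, decrease when the word is prolonged, and change by a factor at most
  \<open>1 + K / N ^ length w\<close> when \<open>w\<close> is prolonged. The last property holds because the scaling function
  is Lipschitz and bounded away from 0, while cylinders shrink geometrically.
\<close>
locale cylinder_weight =
  fixes N :: nat and \<sigma> :: "word \<Rightarrow> real" and m K :: real
  assumes N: "2 \<le> N" and m: "0 < m" and K: "0 \<le> K"
    and ge_m: "set w \<subseteq> letters N \<Longrightarrow> m \<le> \<sigma> w"
    and le_1: "set w \<subseteq> letters N \<Longrightarrow> \<sigma> w \<le> 1"
    and antimono: "set w \<subseteq> letters N \<Longrightarrow> set u \<subseteq> letters N \<Longrightarrow> \<sigma> (w @ u) \<le> \<sigma> w"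
    and distortion: "set w \<subseteq> letters N \<Longrightarrow> set u \<subseteq> letters N \<Longrightarrow>
      \<sigma> w \<le> (1 + K / real N ^ length w) * \<sigma> (w @ u)"
begin

lemma N_pos: "0 < N" using N by simp

lemma pos: "set w \<subseteq> letters N \<Longrightarrow> 0 < \<sigma> w"
  using ge_m m by force

lemma suffix_prod_pos:
  "set u \<subseteq> letters N \<Longrightarrow> set v \<subseteq> letters N \<Longrightarrow> 0 < suffix_prod (\<lambda>u'. \<sigma> (u' @ v)) u"
  by (induction u) (auto intro!: mult_pos_pos pos)

lemma suffix_prod_le_1:
  "set u \<subseteq> letters N \<Longrightarrow> set v \<subseteq> letters N \<Longrightarrow> suffix_prod (\<lambda>u'. \<sigma> (u' @ v)) u \<le> 1"
proof (induction u)
  case (Cons a u)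
  then show ?case using suffix_prod_pos[of u v] pos[of "a # u @ v"]
    by (auto intro!: mult_le_one le_1)
qed simp

lemma suffix_prod_ge:
  "set u \<subseteq> letters N \<Longrightarrow> m ^ length u \<le> suffix_prod \<sigma> u"
  using m by (induction u) (auto intro!: mult_mono ge_m order.strict_implies_order[OF pos])

lemma suffix_prod_antimono:
  "set u \<subseteq> letters N \<Longrightarrow> set v \<subseteq> letters N \<Longrightarrow>
   suffix_prod (\<lambda>u'. \<sigma> (u' @ v)) u \<le> suffix_prod \<sigma> u"
proof (induction u)
  case (Cons a u)
  then show ?case
    using suffix_prod_pos[of u v] antimono[of "a # u" v] pos[of "a # u"]
    by (auto intro!: mult_mono)
qed simp

text \<open>
  Prolonging a word by \<open>v\<close> changes its suffix product by a factor bounded independently of both words,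
  because the exponents \<open>K / N ^ k\<close> of the single distortion factors have a geometric sum that is at
  most \<open>K\<close>.
\<close>
lemma bounded_distortion:
  assumes "set u \<subseteq> letters N" "set v \<subseteq> letters N"
  shows "suffix_prod \<sigma> u \<le> exp K * suffix_prod (\<lambda>u'. \<sigma> (u' @ v)) u"
proof -
  have "suffix_prod \<sigma> u \<le>
      exp (K * (1 - 1 / 2 ^ length u)) * suffix_prod (\<lambda>u'. \<sigma> (u' @ v)) u"
    using assms(1)
  proof (induction u)
    case (Cons a u)
    let ?n = "length u"
    let ?Q = "suffix_prod (\<lambda>u'. \<sigma> (u' @ v))"
    have u: "set u \<subseteq> letters N" "set (a # u) \<subseteq> letters N" using Cons.prems by auto
    have "1 + K / real N ^ Suc ?n \<le> 1 + K / 2 ^ Suc ?n"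
      using N K by (intro add_left_mono divide_left_mono power_mono) auto
    also have "\<dots> \<le> exp (K / 2 ^ Suc ?n)" by (rule exp_ge_add_one_self)
    finally have "(1 + K / real N ^ Suc ?n) * \<sigma> ((a # u) @ v) \<le> exp (K / 2 ^ Suc ?n) * \<sigma> ((a # u) @ v)"
      using pos[of "(a # u) @ v"] u assms(2) by (intro mult_right_mono) auto
    with distortion[OF u(2) assms(2)]
    have 1: "\<sigma> (a # u) \<le> exp (K / 2 ^ Suc ?n) * \<sigma> ((a # u) @ v)" by simp
    have "suffix_prod \<sigma> (a # u) \<le> (exp (K / 2 ^ Suc ?n) * \<sigma> ((a # u) @ v)) *
        (exp (K * (1 - 1 / 2 ^ ?n)) * ?Q u)"
      using 1 Cons.IH[OF u(1)] suffix_prod_pos[OF u(1), of "[]"] pos[of "(a # u) @ v"] u assms(2)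
      by (auto intro!: mult_mono)
    also have "\<dots> = exp (K / 2 ^ Suc ?n + K * (1 - 1 / 2 ^ ?n)) * ?Q (a # u)"
      by (simp add: exp_add)
    also have "K / 2 ^ Suc ?n + K * (1 - 1 / 2 ^ ?n) = K * (1 - 1 / 2 ^ length (a # u))"
      by (simp add: field_simps)
    finally show ?case .
  qed simp
  also have "\<dots> \<le> exp K * suffix_prod (\<lambda>u'. \<sigma> (u' @ v)) u"
    using K suffix_prod_pos[OF assms]
    by (intro mult_right_mono) (auto simp: mult_left_le)
  finally show ?thesis .
qed

definition cylinder_sum :: "nat \<Rightarrow> real" where
  "cylinder_sum k = (\<Sum>u\<in>words N k. suffix_prod \<sigma> u)"

lemma cylinder_sum_0: "cylinder_sum 0 = 1"
  by (simp add: cylinder_sum_def)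

lemma cylinder_sum_ge: "(real N ^ 2 * m) ^ k \<le> cylinder_sum k"
proof -
  have "(real N ^ 2 * m) ^ k = (\<Sum>u\<in>words N k. m ^ k)"
    by (simp add: card_words power_mult_distrib power_mult)
  also have "\<dots> \<le> cylinder_sum k"
    unfolding cylinder_sum_def using suffix_prod_ge by (intro sum_mono) (auto simp: words_def)
  finally show ?thesis .
qed

lemma cylinder_sum_pos: "0 < cylinder_sum k"
  using cylinder_sum_ge[of k] m N_pos
  by (meson less_le_trans mult_pos_pos of_nat_0_less_iff zero_less_power)

lemma cylinder_sum_submult: "cylinder_sum (j + k) \<le> cylinder_sum j * cylinder_sum k"
proof -
  have "cylinder_sum (j + k) =
      (\<Sum>u\<in>words N j. \<Sum>v\<in>words N k. suffix_prod (\<lambda>u'. \<sigma> (u' @ v)) u * suffix_prod \<sigma> v)"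
    by (simp add: cylinder_sum_def sum_words_add suffix_prod_append)
  also have "\<dots> \<le> (\<Sum>u\<in>words N j. \<Sum>v\<in>words N k. suffix_prod \<sigma> u * suffix_prod \<sigma> v)"
    using suffix_prod_antimono suffix_prod_pos[of _ "[]"]
    by (intro sum_mono mult_right_mono) (auto simp: words_def less_imp_le)
  also have "\<dots> = cylinder_sum j * cylinder_sum k"
    by (simp add: cylinder_sum_def sum_product)
  finally show ?thesis .
qed

text \<open>
  Since \<open>cylinder_sum\<close> is submultiplicative, the infimum of \<open>root k (cylinder_sum k)\<close> is also its limit
  (Fekete). The two bounds \<open>growth_rate_power_le\<close> and \<open>cylinder_sum_le_power\<close> express this without
  limits.
\<close>
definition growth_rate :: real where
  "growth_rate = (INF k\<in>{1..}. root k (cylinder_sum k))"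

lemma growth_rate_pos: "0 < growth_rate"
proof -
  have "real N ^ 2 * m \<le> growth_rate"
    unfolding growth_rate_def
  proof (rule cINF_greatest)
    fix k :: nat assume k: "k \<in> {1..}"
    have "root k ((real N ^ 2 * m) ^ k) \<le> root k (cylinder_sum k)"
      using k cylinder_sum_ge by (intro real_root_le_mono) auto
    then show "real N ^ 2 * m \<le> root k (cylinder_sum k)"
      using k m by (simp add: real_root_power_cancel)
  qed auto
  then show ?thesis using N_pos m
    by (meson less_le_trans mult_pos_pos of_nat_0_less_iff zero_less_power)
qed

lemma growth_rate_power_le: "growth_rate ^ k \<le> cylinder_sum k"
proof (cases "k = 0")
  case False
  have "growth_rate \<le> root k (cylinder_sum k)"
    unfolding growth_rate_def using False cylinder_sum_pos
    by (intro cINF_lower bdd_belowI2[of _ 0]) (auto intro: less_imp_le)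
  then have "growth_rate ^ k \<le> root k (cylinder_sum k) ^ k"
    using growth_rate_pos by (intro power_mono) auto
  then show ?thesis using False cylinder_sum_pos[of k] by simp
qed (simp add: cylinder_sum_0)

lemma cylinder_sum_less_power:
  assumes "growth_rate < \<tau>"
  obtains k where "0 < k" "cylinder_sum k < \<tau> ^ k"
proof -
  have "\<exists>k\<in>{1..}. root k (cylinder_sum k) < \<tau>"
    using assms cylinder_sum_pos unfolding growth_rate_def
    by (subst (asm) cINF_less_iff) (auto intro!: bdd_belowI2[of _ 0] intro: less_imp_le)
  then obtain k where k: "1 \<le> k" "root k (cylinder_sum k) < \<tau>" by auto
  then have "root k (cylinder_sum k) ^ k < \<tau> ^ k"
    using cylinder_sum_pos[of k] by (intro power_strict_mono) (auto intro: less_imp_le)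
  with k show thesis using cylinder_sum_pos[of k] by (intro that[of k]) auto
qed

end

text \<open>
  Residue classes modulo \<open>k\<close> are treated at once by taking the sum of the initial quotients as constant.
\<close>
lemma exponential_bound_of_periodic_step:
  fixes B :: "nat \<Rightarrow> real"
  assumes k: "0 < k" and \<tau>: "0 < \<tau>" and nonneg: "\<And>p. 0 \<le> B p"
    and step: "\<And>p. B (k + p) \<le> \<tau> ^ k * B p"
  shows "\<exists>C. \<forall>p. B p \<le> C * \<tau> ^ p"
proof -
  define C where "C = (\<Sum>j<k. B j / \<tau> ^ j)"
  have "B p \<le> C * \<tau> ^ p" for p
  proof (induction p rule: less_induct)
    case (less p)
    show ?case
    proof (cases "p < k")
      case True
      then have "B p / \<tau> ^ p \<le> C"
        unfolding C_def using nonneg \<tau> by (intro member_le_sum) auto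
      then show ?thesis using \<tau> by (simp add: pos_divide_le_eq)
    next
      case False
      then have "B p \<le> \<tau> ^ k * B (p - k)" using step[of "p - k"] by simp
      also have "\<dots> \<le> \<tau> ^ k * (C * \<tau> ^ (p - k))"
        using less[of "p - k"] False k \<tau> by (intro mult_left_mono) auto
      also have "\<dots> = C * \<tau> ^ p" using False by (simp add: power_add[symmetric])
      finally show ?thesis .
    qed
  qed
  then show ?thesis by blast
qed

context cylinder_weight
begin

lemma cylinder_sum_le_power:
  assumes "growth_rate < \<tau>"
  shows "\<exists>C. \<forall>k. cylinder_sum k \<le> C * \<tau> ^ k"
proof -
  have \<tau>: "0 < \<tau>" using growth_rate_pos assms by simp
  obtain k where k: "0 < k" "cylinder_sum k < \<tau> ^ k" by (rule cylinder_sum_less_power[OF assms])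
  show ?thesis
  proof (rule exponential_bound_of_periodic_step[OF k(1) \<tau>])
    show "cylinder_sum (k + p) \<le> \<tau> ^ k * cylinder_sum p" for p
      using cylinder_sum_submult[of k p] k(2) cylinder_sum_pos[of p]
      by (smt (verit) mult_right_mono)
  qed (simp add: cylinder_sum_pos less_imp_le)
qed

lemma cylinder_sum_split:
  "cylinder_sum (n + k) = (\<Sum>w\<in>words N n. \<Sum>u\<in>words N k. suffix_prod \<sigma> (w @ u))"
  by (simp add: cylinder_sum_def sum_words_add)

lemma suffix_sum_Suc:
  assumes "w \<noteq> []"
  shows "(\<Sum>u\<in>words N (Suc k). suffix_prod \<sigma> (w @ u)) =
    (\<Sum>a\<in>letters N. \<Sum>u\<in>words N k. \<sigma> (w @ a # u) * suffix_prod \<sigma> ((tl w @ [a]) @ u))"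
  using assms by (cases w) (auto simp: sum_words_Suc)

text \<open>
  Deleting the first letter of \<open>w\<close> and appending a new one turns the sum of suffix products over all
  prolongations of \<open>w\<close> into sums of the same kind. This is the recursion of \<open>word_row_sum\<close>, except that
  the weight of the whole prolonged word takes the place of the weight of its first \<open>n + 1\<close> letters.
  Comparing the two weights therefore compares the sums, with one factor \<open>C\<close> for each step.
\<close>
lemma suffix_sum_le_row_sum:
  assumes n: "0 < n" and C: "0 \<le> C"
    and s: "\<And>w. w \<in> words N (Suc n) \<Longrightarrow> 0 \<le> s w"
    and le: "\<And>w u. w \<in> words N (Suc n) \<Longrightarrow> set u \<subseteq> letters N \<Longrightarrow> \<sigma> (w @ u) \<le> C * s w"
    and w: "w \<in> words N n"
  shows "(\<Sum>u\<in>words N k. suffix_prod \<sigma> (w @ u)) \<le> C ^ k * word_row_sum N s k w"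
  using w
proof (induction k arbitrary: w)
  case 0
  then show ?case using suffix_prod_le_1[of w "[]"] by (auto simp: words_def[of N n])
next
  case (Suc k)
  have w: "w \<noteq> []" "set w \<subseteq> letters N" "length w = n" using n Suc.prems by (auto simp: words_def)
  have step: "w @ [a] \<in> words N (Suc n)" "tl w @ [a] \<in> words N n" if "a \<in> letters N" for a
    using w that n by (auto simp: words_def dest: list.set_sel(2))
  have "(\<Sum>u\<in>words N (Suc k). suffix_prod \<sigma> (w @ u)) =
    (\<Sum>a\<in>letters N. \<Sum>u\<in>words N k. \<sigma> (w @ a # u) * suffix_prod \<sigma> ((tl w @ [a]) @ u))"
    by (rule suffix_sum_Suc[OF w(1)])
  also have "\<dots> \<le> (\<Sum>a\<in>letters N. \<Sum>u\<in>words N k. (C * s (w @ [a])) * suffix_prod \<sigma> ((tl w @ [a]) @ u))"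
  proof (intro sum_mono mult_right_mono)
    fix a u assume a: "a \<in> letters N" and u: "u \<in> words N k"
    show "\<sigma> (w @ a # u) \<le> C * s (w @ [a])"
      using le[OF step(1)[OF a], of u] u by (simp add: words_def)
    show "0 \<le> suffix_prod \<sigma> ((tl w @ [a]) @ u)"
      using step(2)[OF a] u suffix_prod_pos[of "(tl w @ [a]) @ u" "[]"] by (simp add: words_def)
  qed
  also have "\<dots> = (\<Sum>a\<in>letters N. C * s (w @ [a]) * (\<Sum>u\<in>words N k. suffix_prod \<sigma> ((tl w @ [a]) @ u)))"
    by (simp add: sum_distrib_left)
  also have "\<dots> \<le> (\<Sum>a\<in>letters N. C * s (w @ [a]) * (C ^ k * word_row_sum N s k (tl w @ [a])))"
    by (intro sum_mono mult_left_mono Suc.IH step mult_nonneg_nonneg C s)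
  also have "\<dots> = C ^ Suc k * word_row_sum N s (Suc k) w"
    by (simp add: sum_distrib_left mult_ac)
  finally show ?case .
qed

lemma row_sum_le_suffix_sum:
  assumes n: "0 < n" and c: "0 \<le> c"
    and s: "\<And>w. w \<in> words N (Suc n) \<Longrightarrow> 0 \<le> s w"
    and le: "\<And>w u. w \<in> words N (Suc n) \<Longrightarrow> set u \<subseteq> letters N \<Longrightarrow> s w \<le> c * \<sigma> (w @ u)"
    and w: "w \<in> words N n"
  shows "m ^ n * word_row_sum N s k w \<le> c ^ k * (\<Sum>u\<in>words N k. suffix_prod \<sigma> (w @ u))"
  using w
proof (induction k arbitrary: w)
  case 0
  then show ?case using suffix_prod_ge[of w] by (auto simp: words_def[of N n])
next
  case (Suc k)
  have w: "w \<noteq> []" "set w \<subseteq> letters N" "length w = n" using n Suc.prems by (auto simp: words_def)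
  have step: "w @ [a] \<in> words N (Suc n)" "tl w @ [a] \<in> words N n" if "a \<in> letters N" for a
    using w that n by (auto simp: words_def dest: list.set_sel(2))
  have "m ^ n * word_row_sum N s (Suc k) w =
      (\<Sum>a\<in>letters N. s (w @ [a]) * (m ^ n * word_row_sum N s k (tl w @ [a])))"
    by (simp add: sum_distrib_left mult_ac)
  also have "\<dots> \<le> (\<Sum>a\<in>letters N. s (w @ [a]) * (c ^ k * (\<Sum>u\<in>words N k. suffix_prod \<sigma> ((tl w @ [a]) @ u))))"
    by (intro sum_mono mult_left_mono Suc.IH step s)
  also have "\<dots> = (\<Sum>a\<in>letters N. \<Sum>u\<in>words N k. s (w @ [a]) * (c ^ k * suffix_prod \<sigma> ((tl w @ [a]) @ u)))"
    by (simp add: sum_distrib_left)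
  also have "\<dots> \<le> (\<Sum>a\<in>letters N. \<Sum>u\<in>words N k.
      (c * \<sigma> (w @ a # u)) * (c ^ k * suffix_prod \<sigma> ((tl w @ [a]) @ u)))"
  proof (intro sum_mono mult_right_mono)
    fix a u assume a: "a \<in> letters N" and u: "u \<in> words N k"
    show "s (w @ [a]) \<le> c * \<sigma> (w @ a # u)"
      using le[OF step(1)[OF a], of u] u by (simp add: words_def)
    show "0 \<le> c ^ k * suffix_prod \<sigma> ((tl w @ [a]) @ u)"
      using step(2)[OF a] u suffix_prod_pos[of "(tl w @ [a]) @ u" "[]"] c by (simp add: words_def)
  qed
  also have "\<dots> = c ^ Suc k * (\<Sum>a\<in>letters N. \<Sum>u\<in>words N k. \<sigma> (w @ a # u) * suffix_prod \<sigma> ((tl w @ [a]) @ u))"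
    by (simp add: sum_distrib_left mult_ac)
  also have "\<dots> = c ^ Suc k * (\<Sum>u\<in>words N (Suc k). suffix_prod \<sigma> (w @ u))"
    by (simp only: suffix_sum_Suc[OF w(1)])
  finally show ?case .
qed

text \<open>
  A comparison of weights up to a constant becomes the same comparison of exponential growth rates:
  \<open>growth_rate\<close> is the rate of the suffix products and, by the two halves of Gelfand's formula, the
  spectral radius is the rate of the row sums.
\<close>
lemma growth_rate_le_spectral_radius:
  assumes n: "0 < n" and C: "0 < C"
    and s: "\<And>w. w \<in> words N (Suc n) \<Longrightarrow> 0 \<le> s w"
    and le: "\<And>w u. w \<in> words N (Suc n) \<Longrightarrow> set u \<subseteq> letters N \<Longrightarrow> \<sigma> (w @ u) \<le> C * s w"
  shows "growth_rate \<le> C * spectral_radius (word_matrix N s n)"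
proof -
  let ?\<rho> = "spectral_radius (word_matrix N s n)"
  have \<rho>0: "0 \<le> ?\<rho>" by (rule spectral_radius_word_matrix_nonneg[of n N s, OF n N_pos s])
  have "growth_rate \<le> C * \<tau>" if \<tau>: "?\<rho> < \<tau>" for \<tau>
  proof -
    have \<tau>0: "0 < \<tau>" using \<rho>0 \<tau> by simp
    obtain B where B: "\<And>k. (\<Sum>w\<in>words N n. word_row_sum N s k w) \<le> B * \<tau> ^ k"
      using word_row_sum_le_power[of n N s \<tau>, OF n N_pos s \<tau>] by blast
    have "growth_rate ^ k \<le> (B / growth_rate ^ n) * (C * \<tau>) ^ k" for k
    proof -
      have "growth_rate ^ (n + k) \<le> (\<Sum>w\<in>words N n. \<Sum>u\<in>words N k. suffix_prod \<sigma> (w @ u))"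
        using growth_rate_power_le[of "n + k"] by (simp add: cylinder_sum_split)
      also have "\<dots> \<le> (\<Sum>w\<in>words N n. C ^ k * word_row_sum N s k w)"
        using suffix_sum_le_row_sum[OF n _ s le] C by (intro sum_mono) auto
      also have "\<dots> \<le> C ^ k * (B * \<tau> ^ k)"
        using B C by (simp add: sum_distrib_left[symmetric])
      finally show ?thesis
        using growth_rate_pos by (simp add: power_add power_mult_distrib field_simps)
    qed
    from le_if_powers_le[OF growth_rate_pos _ this] show ?thesis using C \<tau>0 by simp
  qed
  then have "growth_rate / C \<le> \<tau>" if "?\<rho> < \<tau>" for \<tau>
    using that C by (simp add: pos_divide_le_eq mult.commute[of \<tau> C])
  then have "growth_rate / C \<le> ?\<rho>" by (rule dense_ge)
  then show ?thesis using C by (simp add: pos_divide_le_eq mult.commute)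
qed

lemma spectral_radius_le_growth_rate:
  assumes n: "0 < n" and c: "0 < c"
    and s: "\<And>w. w \<in> words N (Suc n) \<Longrightarrow> 0 \<le> s w"
    and le: "\<And>w u. w \<in> words N (Suc n) \<Longrightarrow> set u \<subseteq> letters N \<Longrightarrow> s w \<le> c * \<sigma> (w @ u)"
  shows "spectral_radius (word_matrix N s n) \<le> c * growth_rate"
proof (cases "spectral_radius (word_matrix N s n) = 0")
  case True
  then show ?thesis using c growth_rate_pos by simp
next
  case False
  let ?\<rho> = "spectral_radius (word_matrix N s n)"
  have \<rho>0: "0 < ?\<rho>"
    using False spectral_radius_word_matrix_nonneg[of n N s, OF n N_pos s] by simp
  have "?\<rho> \<le> c * \<tau>" if \<tau>: "growth_rate < \<tau>" for \<tau>
  proof -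
    have \<tau>0: "0 < \<tau>" using growth_rate_pos \<tau> by simp
    obtain B where B: "\<And>k. cylinder_sum k \<le> B * \<tau> ^ k"
      using cylinder_sum_le_power[OF \<tau>] by blast
    have "?\<rho> ^ k \<le> (B * \<tau> ^ n / m ^ n) * (c * \<tau>) ^ k" for k
    proof -
      have "m ^ n * ?\<rho> ^ k \<le> m ^ n * (\<Sum>w\<in>words N n. word_row_sum N s k w)"
        using spectral_radius_word_matrix_power_le[of n N s, OF n N_pos s] m by (intro mult_left_mono) auto
      also have "\<dots> \<le> (\<Sum>w\<in>words N n. c ^ k * (\<Sum>u\<in>words N k. suffix_prod \<sigma> (w @ u)))"
        using row_sum_le_suffix_sum[OF n _ s le] c
        by (auto simp: sum_distrib_left intro!: sum_mono)
      also have "\<dots> \<le> c ^ k * (B * \<tau> ^ (n + k))"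
        using B[of "n + k"] c by (simp add: sum_distrib_left[symmetric] cylinder_sum_split)
      finally show ?thesis
        using m by (simp add: power_add power_mult_distrib field_simps)
    qed
    from le_if_powers_le[OF \<rho>0 _ this] show ?thesis using c \<tau>0 by simp
  qed
  then have "?\<rho> / c \<le> \<tau>" if "growth_rate < \<tau>" for \<tau>
    using that c by (simp add: pos_divide_le_eq mult.commute)
  then have "?\<rho> / c \<le> growth_rate" by (rule dense_ge)
  then show ?thesis using c by (simp add: pos_divide_le_eq mult.commute)
qed

lemma distortion_constant_tendsto: "(\<lambda>n. 1 + K / real N ^ Suc n) \<longlonglongrightarrow> 1"
proof -
  have "(\<lambda>n. (1 / real N) ^ n) \<longlonglongrightarrow> 0"
    using N by (intro LIMSEQ_power_zero) auto
  then have "(\<lambda>n. (1 / real N) ^ Suc n) \<longlonglongrightarrow> 0"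
    by (rule LIMSEQ_Suc)
  from tendsto_add[OF tendsto_const[of 1] tendsto_mult[OF tendsto_const[of K] this]]
  show ?thesis by (simp add: power_divide)
qed

text \<open>
  The weights of a word of length \<open>n + 1\<close> and of its prolongations differ by a factor at most
  \<open>1 + K / N ^ (n + 1)\<close>, so the spectral radius of the \<open>n\<close>-th matrix is squeezed between the growth rate
  and a multiple of it that tends to it. The same works for every weight \<open>s\<close> within this factor
  of \<open>\<sigma>\<close>, in particular for the infima of \<open>\<bar>S\<bar>\<close> over cylinders.
\<close>
lemma spectral_radius_upper_tendsto:
  "(\<lambda>n. spectral_radius (word_matrix N \<sigma> n)) \<longlonglongrightarrow> growth_rate"
proof (rule tendsto_sandwich)
  let ?c = "\<lambda>n. 1 + K / real N ^ Suc n"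
  show "\<forall>\<^sub>F n in sequentially. growth_rate \<le> spectral_radius (word_matrix N \<sigma> n)"
    using eventually_gt_at_top[of 0]
  proof eventually_elim
    case (elim n)
    show ?case
      using growth_rate_le_spectral_radius[of n 1 \<sigma>] elim pos antimono
      by (auto simp: words_def less_imp_le)
  qed
  show "\<forall>\<^sub>F n in sequentially. spectral_radius (word_matrix N \<sigma> n) \<le> ?c n * growth_rate"
    using eventually_gt_at_top[of 0]
  proof eventually_elim
    case (elim n)
    have "0 < ?c n" using K N_pos by (intro add_pos_nonneg) auto
    show ?case
    proof (rule spectral_radius_le_growth_rate[OF elim \<open>0 < ?c n\<close>])
      show "0 \<le> \<sigma> w" if "w \<in> words N (Suc n)" for w
        using that pos[of w] by (simp add: words_def)
      show "\<sigma> w \<le> ?c n * \<sigma> (w @ u)" if "w \<in> words N (Suc n)" "set u \<subseteq> letters N" for w u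
        using that distortion[of w u] by (simp add: words_def)
    qed
  qed
  show "(\<lambda>n. ?c n * growth_rate) \<longlonglongrightarrow> growth_rate"
    using tendsto_mult[OF distortion_constant_tendsto tendsto_const[of growth_rate]] by simp
qed (rule tendsto_const)

lemma spectral_radius_lower_tendsto:
  assumes s: "\<And>w. set w \<subseteq> letters N \<Longrightarrow> 0 \<le> s w"
    and le: "\<And>w u. set w \<subseteq> letters N \<Longrightarrow> set u \<subseteq> letters N \<Longrightarrow> s w \<le> \<sigma> (w @ u)"
    and ge: "\<And>w. set w \<subseteq> letters N \<Longrightarrow> \<sigma> w \<le> (1 + K / real N ^ length w) * s w"
  shows "(\<lambda>n. spectral_radius (word_matrix N s n)) \<longlonglongrightarrow> growth_rate"
proof (rule tendsto_sandwich)
  let ?c = "\<lambda>n. 1 + K / real N ^ Suc n"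
  have c: "0 < ?c n" for n using K N_pos by (intro add_pos_nonneg) auto
  show "\<forall>\<^sub>F n in sequentially. spectral_radius (word_matrix N s n) \<le> growth_rate"
    using eventually_gt_at_top[of 0]
  proof eventually_elim
    case (elim n)
    show ?case
      using spectral_radius_le_growth_rate[of n 1 s] elim s le by (auto simp: words_def)
  qed
  show "\<forall>\<^sub>F n in sequentially. growth_rate / ?c n \<le> spectral_radius (word_matrix N s n)"
    using eventually_gt_at_top[of 0]
  proof eventually_elim
    case (elim n)
    have "growth_rate \<le> ?c n * spectral_radius (word_matrix N s n)"
    proof (rule growth_rate_le_spectral_radius[OF elim c])
      fix w u assume w: "w \<in> words N (Suc n)" and u: "set u \<subseteq> letters N"
      then have "\<sigma> (w @ u) \<le> \<sigma> w" by (intro antimono) (auto simp: words_def)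
      also have "\<dots> \<le> ?c n * s w" using ge[of w] w by (simp add: words_def)
      finally show "\<sigma> (w @ u) \<le> ?c n * s w" .
    qed (use s in \<open>auto simp: words_def\<close>)
    then show ?case using c[of n] by (simp only: pos_divide_le_eq mult.commute)
  qed
  show "(\<lambda>n. growth_rate / ?c n) \<longlonglongrightarrow> growth_rate"
    using tendsto_divide[OF tendsto_const[of growth_rate] distortion_constant_tendsto] by simp
qed (rule tendsto_const)

end

section \<open>Sums satisfying a recursion with geometric error\<close>

text \<open>
  Prefixing a letter to \<open>w\<close> multiplies the oscillation by the weight, up to an error of the order of the
  diameter of the cylinder. After summing over the \<open>N ^ (2 * p)\<close> words of length \<open>p\<close> the error is of order
  \<open>N ^ p\<close>, which is why \<open>N\<close> is the critical value of the growth rate.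
\<close>
locale oscillation_system = cylinder_weight +
  fixes osc_of :: "word \<Rightarrow> real" and H :: real
  assumes osc_nonneg: "set w \<subseteq> letters N \<Longrightarrow> 0 \<le> osc_of w"
    and H: "0 \<le> H"
    and osc_Cons: "a \<in> letters N \<Longrightarrow> set w \<subseteq> letters N \<Longrightarrow>
      \<bar>osc_of (a # w) - \<sigma> (a # w) * osc_of w\<bar> \<le> H / real N ^ length w"
begin

definition osc_total :: "nat \<Rightarrow> real" where
  "osc_total p = (\<Sum>w\<in>words N p. osc_of w)"

lemma osc_total_nonneg: "0 \<le> osc_total p"
  unfolding osc_total_def by (intro sum_nonneg osc_nonneg) (simp add: words_def)

lemma osc_append:
  assumes "set u \<subseteq> letters N" "set v \<subseteq> letters N"
  shows "\<bar>osc_of (u @ v) - suffix_prod (\<lambda>u'. \<sigma> (u' @ v)) u * osc_of v\<bar>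
    \<le> length u * (H / real N ^ length v)"
  using assms(1)
proof (induction u)
  case (Cons a u)
  let ?Q = "suffix_prod (\<lambda>u'. \<sigma> (u' @ v)) u" and ?s = "\<sigma> (a # u @ v)"
  have u: "a \<in> letters N" "set u \<subseteq> letters N" "set (u @ v) \<subseteq> letters N" "set (a # u @ v) \<subseteq> letters N"
    using Cons.prems assms(2) by auto
  have "\<bar>osc_of (a # u @ v) - ?s * osc_of (u @ v)\<bar> \<le> H / real N ^ length (u @ v)"
    by (rule osc_Cons) (use u in auto)
  also have "\<dots> \<le> H / real N ^ length v"
    using H N_pos by (intro divide_left_mono power_increasing) auto
  finally have 1: "\<bar>osc_of (a # u @ v) - ?s * osc_of (u @ v)\<bar> \<le> H / real N ^ length v" .
  have "\<bar>?s * osc_of (u @ v) - ?s * (?Q * osc_of v)\<bar> = ?s * \<bar>osc_of (u @ v) - ?Q * osc_of v\<bar>"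
    using pos[OF u(4)] by (simp add: abs_mult right_diff_distrib[symmetric])
  also have "\<dots> \<le> 1 * (length u * (H / real N ^ length v))"
    using le_1[OF u(4)] pos[OF u(4)] Cons.IH[OF u(2)] by (intro mult_mono) auto
  finally have 2: "\<bar>?s * osc_of (u @ v) - ?s * (?Q * osc_of v)\<bar> \<le> length u * (H / real N ^ length v)" by simp
  have "\<bar>osc_of ((a # u) @ v) - suffix_prod (\<lambda>u'. \<sigma> (u' @ v)) (a # u) * osc_of v\<bar> =
    \<bar>(osc_of (a # u @ v) - ?s * osc_of (u @ v)) + (?s * osc_of (u @ v) - ?s * (?Q * osc_of v))\<bar>"
    by (simp add: algebra_simps)
  also have "\<dots> \<le> H / real N ^ length v + length u * (H / real N ^ length v)"
    using 1 2 by linarith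
  also have "\<dots> = length (a # u) * (H / real N ^ length v)" by (simp add: algebra_simps add_divide_distrib)
  finally show ?case .
qed simp

definition step_error :: "nat \<Rightarrow> real" where
  "step_error k = real N ^ (2 * k) * (real k * H)"

lemma step_error_nonneg: "0 \<le> step_error k"
  using H by (simp add: step_error_def)

lemma sum_step_error:
  "(\<Sum>u\<in>words N k. \<Sum>v\<in>words N p. real (length u) * (H / real N ^ length v)) = step_error k * real N ^ p"
proof -
  have "(\<Sum>u\<in>words N k. \<Sum>v\<in>words N p. real (length u) * (H / real N ^ length v))
    = (\<Sum>u\<in>words N k. \<Sum>v\<in>words N p. real k * (H / real N ^ p))"
    by (intro sum.cong) (auto simp: words_def)
  also have "\<dots> = real N ^ (2 * k) * (real N ^ (2 * p) * (real k * (H / real N ^ p)))"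
    by (simp add: card_words)
  also have "real N ^ (2 * p) = real N ^ p * real N ^ p"
    by (simp add: mult_2 power_add)
  finally show ?thesis using N_pos by (simp add: step_error_def)
qed

lemma osc_total_le: "osc_total (k + p) \<le> cylinder_sum k * osc_total p + step_error k * real N ^ p"
proof -
  have "osc_total (k + p) = (\<Sum>u\<in>words N k. \<Sum>v\<in>words N p. osc_of (u @ v))"
    by (simp add: osc_total_def sum_words_add)
  also have "\<dots> \<le> (\<Sum>u\<in>words N k. \<Sum>v\<in>words N p.
      suffix_prod \<sigma> u * osc_of v + real (length u) * (H / real N ^ length v))"
  proof (intro sum_mono)
    fix u v assume "u \<in> words N k" "v \<in> words N p"
    then have w: "set u \<subseteq> letters N" "set v \<subseteq> letters N" by (auto simp: words_def)
    have "suffix_prod (\<lambda>u'. \<sigma> (u' @ v)) u * osc_of v \<le> suffix_prod \<sigma> u * osc_of v"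
      by (intro mult_right_mono suffix_prod_antimono w osc_nonneg)
    then show "osc_of (u @ v) \<le> suffix_prod \<sigma> u * osc_of v + real (length u) * (H / real N ^ length v)"
      using osc_append[OF w] by linarith
  qed
  also have "\<dots> = cylinder_sum k * osc_total p + step_error k * real N ^ p"
    by (simp only: sum.distrib sum_step_error) (simp add: cylinder_sum_def osc_total_def sum_product)
  finally show ?thesis .
qed

text \<open>
  The weight factor of \<open>u\<close> in front of \<open>osc_of v\<close> depends on \<open>v\<close>. Bounded distortion replaces it by the
  suffix product of \<open>u\<close> alone at the cost of the factor \<open>exp (- K)\<close>, so that the double sum factorises.
\<close>
lemma osc_total_ge:
  "exp (- K) * cylinder_sum k * osc_total p - step_error k * real N ^ p \<le> osc_total (k + p)"
proof -
  have "exp (- K) * cylinder_sum k * osc_total p - step_error k * real N ^ p =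
    (\<Sum>u\<in>words N k. \<Sum>v\<in>words N p.
      exp (- K) * (suffix_prod \<sigma> u * osc_of v) - real (length u) * (H / real N ^ length v))"
    by (simp only: sum_subtractf sum_step_error)
      (simp add: cylinder_sum_def osc_total_def sum_product sum_distrib_left mult_ac)
  also have "\<dots> \<le> (\<Sum>u\<in>words N k. \<Sum>v\<in>words N p. osc_of (u @ v))"
  proof (intro sum_mono)
    fix u v assume "u \<in> words N k" "v \<in> words N p"
    then have w: "set u \<subseteq> letters N" "set v \<subseteq> letters N" by (auto simp: words_def)
    have "exp (- K) * suffix_prod \<sigma> u \<le> suffix_prod (\<lambda>u'. \<sigma> (u' @ v)) u"
      using bounded_distortion[OF w] by (simp add: exp_minus field_simps)
    then have "exp (- K) * suffix_prod \<sigma> u * osc_of v \<le> suffix_prod (\<lambda>u'. \<sigma> (u' @ v)) u * osc_of v"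
      by (intro mult_right_mono osc_nonneg w)
    then show "exp (- K) * (suffix_prod \<sigma> u * osc_of v) - real (length u) * (H / real N ^ length v)
        \<le> osc_of (u @ v)"
      using osc_append[OF w] by (simp only: mult.assoc)
  qed
  also have "\<dots> = osc_total (k + p)" by (simp add: osc_total_def sum_words_add)
  finally show ?thesis .
qed

text \<open>
  Choose \<open>k\<close> with \<open>cylinder_sum k < \<tau> ^ k\<close>. Adding a suitable multiple of \<open>N ^ p\<close> absorbs the error:
  the corrected sums grow by a factor at most \<open>\<tau> ^ k\<close> in \<open>k\<close> steps.
\<close>
lemma osc_total_le_power:
  assumes "growth_rate < \<tau>" "real N < \<tau>"
  shows "\<exists>C. \<forall>p. osc_total p \<le> C * \<tau> ^ p"
proof -
  obtain k where k: "0 < k" "cylinder_sum k < \<tau> ^ k" by (rule cylinder_sum_less_power[OF assms(1)])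
  have \<tau>0: "0 < \<tau>" using assms(2) by linarith
  have gap: "real N ^ k < \<tau> ^ k"
    using assms(2) k(1) by (intro power_strict_mono) auto
  \<comment> \<open>The multiple \<open>c * N ^ p\<close> reproduces itself under the recursion with factor \<open>\<tau> ^ k\<close>.\<close>
  define c where "c = step_error k / (\<tau> ^ k - real N ^ k)"
  have c: "step_error k + c * real N ^ k = c * \<tau> ^ k"
    using gap by (simp add: c_def field_simps)
  have c0: "0 \<le> c" using gap step_error_nonneg by (simp add: c_def)
  have "\<exists>C. \<forall>p. osc_total p + c * real N ^ p \<le> C * \<tau> ^ p"
  proof (rule exponential_bound_of_periodic_step[OF k(1) \<tau>0])
    fix p
    show "0 \<le> osc_total p + c * real N ^ p" using c0 osc_total_nonneg by simp
    have "osc_total (k + p) + c * real N ^ (k + p) \<le>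
        cylinder_sum k * osc_total p + (step_error k + c * real N ^ k) * real N ^ p"
      using osc_total_le[of k p] by (simp add: power_add algebra_simps)
    also have "\<dots> \<le> \<tau> ^ k * osc_total p + (c * \<tau> ^ k) * real N ^ p"
      unfolding c using k(2) osc_total_nonneg by (intro add_right_mono mult_right_mono) auto
    finally show "osc_total (k + p) + c * real N ^ (k + p) \<le> \<tau> ^ k * (osc_total p + c * real N ^ p)"
      by (simp add: algebra_simps)
  qed
  then obtain C where C: "\<And>p. osc_total p + c * real N ^ p \<le> C * \<tau> ^ p" by blast
  have "osc_total p \<le> C * \<tau> ^ p" for p
  proof -
    have "0 \<le> c * real N ^ p" using c0 by simp
    with C[of p] show ?thesis by linarith
  qed
  then show ?thesis by blast
qed

text \<open>
  For large \<open>k\<close> the factor \<open>exp (- K)\<close> is negligible against \<open>(growth_rate / \<tau>) ^ k\<close>, so that \<open>k\<close> steps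
  multiply the sum by at least \<open>\<tau> ^ k\<close>, up to an error of order \<open>N ^ p\<close>. The error can be absorbed by
  subtracting a multiple of \<open>N ^ p\<close>, and growth sets in as soon as the difference is positive. That is
  what unboundedness of \<open>osc_total p / N ^ p\<close> provides.
\<close>
lemma power_le_osc_total:
  assumes \<tau>: "real N < \<tau>" "\<tau> < growth_rate"
    and unbounded: "\<And>T. \<exists>p. T * real N ^ p < osc_total p"
  shows "\<exists>c>0. \<exists>p0. \<forall>p\<ge>p0. c * \<tau> ^ p \<le> osc_total p"
proof -
  have \<tau>1: "1 < \<tau>" using \<tau>(1) N by linarith
  have "1 < growth_rate / \<tau>" using \<tau>(2) \<tau>1 by simp
  then obtain k where "exp K < (growth_rate / \<tau>) ^ k" using real_arch_pow by blast
  then have "exp K * \<tau> ^ k < growth_rate ^ k"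
    using \<tau>1 by (simp add: power_divide pos_less_divide_eq)
  then have "exp K * \<tau> ^ k < cylinder_sum k" using growth_rate_power_le[of k] by linarith
  then have k: "\<tau> ^ k < exp (- K) * cylinder_sum k" by (simp add: exp_minus field_simps)
  have k0: "0 < k"
  proof (rule ccontr)
    assume "\<not> 0 < k"
    then have "exp K < 1" using k by (simp add: cylinder_sum_0 exp_minus field_simps)
    then show False using K by simp
  qed
  have gap: "real N ^ k < \<tau> ^ k"
    using \<tau>(1) k0 by (intro power_strict_mono) auto
  define c where "c = step_error k / (\<tau> ^ k - real N ^ k)"
  have c: "step_error k + c * real N ^ k = c * \<tau> ^ k"
    using gap by (simp add: c_def field_simps)
  define X where "X p = osc_total p - c * real N ^ p" for p
  have X_step: "\<tau> ^ k * X p \<le> X (k + p)" for p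
  proof -
    have "\<tau> ^ k * X p = \<tau> ^ k * osc_total p - (c * \<tau> ^ k) * real N ^ p"
      by (simp add: X_def algebra_simps)
    also have "\<dots> = \<tau> ^ k * osc_total p - (step_error k + c * real N ^ k) * real N ^ p"
      by (simp add: c)
    also have "\<dots> \<le> exp (- K) * cylinder_sum k * osc_total p - (step_error k + c * real N ^ k) * real N ^ p"
      using k osc_total_nonneg by (intro diff_right_mono mult_right_mono) auto
    also have "\<dots> \<le> X (k + p)"
      using osc_total_ge[of k p] by (simp add: X_def power_add algebra_simps)
    finally show ?thesis .
  qed
  have X_iter: "\<tau> ^ (i * k) * X p \<le> X (i * k + p)" for i p
  proof (induction i)
    case (Suc i)
    have "\<tau> ^ (Suc i * k) * X p = \<tau> ^ k * (\<tau> ^ (i * k) * X p)" by (simp add: power_add)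
    also have "\<dots> \<le> \<tau> ^ k * X (i * k + p)" using Suc \<tau>1 by (intro mult_left_mono) auto
    also have "\<dots> \<le> X (Suc i * k + p)" using X_step[of "i * k + p"] by (simp add: add.assoc)
    finally show ?case .
  qed simp
  \<comment> \<open>\<open>g j\<close> is chosen so that a start value above \<open>g j * N ^ p0\<close> makes \<open>X (j + p0)\<close> at least 1; hence one
    \<open>p0\<close> serves all residue classes modulo \<open>k\<close>.\<close>
  define g where "g j = ((c + 1) * real N ^ j + step_error j) / (exp (- K) * cylinder_sum j)" for j
  have c0: "0 \<le> c" using gap step_error_nonneg by (simp add: c_def)
  have g0: "0 \<le> g j" for j
    using c0 step_error_nonneg cylinder_sum_pos by (simp add: g_def less_imp_le)
  obtain p0 where p0: "(\<Sum>j<k. g j) * real N ^ p0 < osc_total p0" using unbounded by blast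
  have start: "1 \<le> X (j + p0)" if j: "j < k" for j
  proof -
    have pos: "0 < exp (- K) * cylinder_sum j" using cylinder_sum_pos by simp
    have "((c + 1) * real N ^ j + step_error j) * real N ^ p0
        = (exp (- K) * cylinder_sum j) * (g j * real N ^ p0)"
      using cylinder_sum_pos[of j] by (simp add: g_def)
    also have "g j \<le> (\<Sum>j<k. g j)" using j g0 by (intro member_le_sum) auto
    then have "(exp (- K) * cylinder_sum j) * (g j * real N ^ p0)
        \<le> (exp (- K) * cylinder_sum j) * ((\<Sum>j<k. g j) * real N ^ p0)"
      using pos by (intro mult_left_mono mult_right_mono) auto
    also have "\<dots> \<le> (exp (- K) * cylinder_sum j) * osc_total p0"
      using pos p0 by (intro mult_left_mono) auto
    finally have "(c + 1) * real N ^ j * real N ^ p0 \<le> osc_total (j + p0)"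
      using osc_total_ge[of j p0] by (simp add: algebra_simps)
    then have "real N ^ (j + p0) \<le> X (j + p0)" by (simp add: X_def power_add algebra_simps)
    moreover have "1 \<le> real N ^ (j + p0)" using N by (intro one_le_power) auto
    ultimately show ?thesis by linarith
  qed
  have "(1 / \<tau> ^ (k + p0)) * \<tau> ^ p \<le> osc_total p" if p: "p0 \<le> p" for p
  proof -
    define i j where "i = (p - p0) div k" and "j = (p - p0) mod k"
    have j: "j < k" using k0 by (simp add: j_def)
    have p_eq: "p = i * k + (j + p0)" using p by (simp add: i_def j_def)
    have "(1 / \<tau> ^ (k + p0)) * \<tau> ^ p = \<tau> ^ (i * k) * (\<tau> ^ (j + p0) / \<tau> ^ (k + p0))"
      by (simp add: p_eq power_add)
    also have "\<dots> \<le> \<tau> ^ (i * k) * 1"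
      using j \<tau>1 by (intro mult_left_mono) (auto simp: power_increasing)
    also have "\<dots> \<le> \<tau> ^ (i * k) * X (j + p0)"
      using start[OF j] \<tau>1 by (intro mult_left_mono) auto
    also have "\<dots> \<le> X p" using X_iter[of i "j + p0"] by (simp add: p_eq)
    also have "\<dots> \<le> osc_total p" using c0 by (simp add: X_def)
    finally show ?thesis .
  qed
  moreover have "0 < 1 / \<tau> ^ (k + p0)" using \<tau>1 by simp
  ultimately show ?thesis by blast
qed

end

section \<open>Folding maps and the cells of the grid\<close>

lemma uniform_partition_point:
  assumes "uniform_partition N x" "i \<le> N"
  shows "x i = x 0 + real i * ((x N - x 0) / real N)"
proof -
  define d where "d = (x N - x 0) / real N"
  have "x i = x 0 + real i * d"
    using assms(2)
  proof (induction i)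
    case (Suc i)
    then have "x (Suc i) - x i = d"
      using assms(1) by (force simp: uniform_partition_def d_def)
    with Suc show ?case by (simp add: algebra_simps)
  qed simp
  then show ?thesis by (simp add: d_def)
qed

lemma uniform_partition_less:
  assumes "uniform_partition N x" "0 < N"
  shows "x 0 < x N"
proof -
  have "0 < x 1 - x 0" "x 1 - x 0 = (x N - x 0) / real N"
    using assms by (force simp: uniform_partition_def)+
  then have "0 < (x N - x 0) / real N" by simp
  then show ?thesis using assms(2) by (simp add: zero_less_divide_iff)
qed

text \<open>
  The folding map with index \<open>i\<close> carries the \<open>a\<close>-th of \<open>M\<close> equal subintervals to the subinterval with this
  index among \<open>N * M\<close>; for even \<open>i\<close> the orientation is reversed.
\<close>
definition fold_step :: "nat \<Rightarrow> nat \<Rightarrow> nat \<Rightarrow> nat" where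
  "fold_step M i a = (if odd i then (i - 1) * M + a else i * M - 1 - a)"

lemma fold_step_div_mod:
  assumes "1 \<le> i" "a < M"
  shows "fold_step M i a div M = i - 1"
    and "fold_step M i a mod M = (if odd i then a else M - 1 - a)"
proof -
  obtain j where j: "i = Suc j" using assms(1) by (cases i) auto
  have *: "fold_step M (Suc j) a = (if odd i then a else M - 1 - a) + j * M"
    using assms(2) by (simp add: fold_step_def j)
  have "(if odd i then a else M - 1 - a) < M" using assms(2) by simp
  then show "fold_step M i a div M = i - 1"
    and "fold_step M i a mod M = (if odd i then a else M - 1 - a)"
    by (simp_all add: * j)
qed

lemma fold_step_less:
  assumes "i \<in> {1..N}" "a < M"
  shows "fold_step M i a < N * M"
proof -
  have "i - 1 < N" using assms(1) by (cases i) auto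
  then have "fold_step M i a div M < N" using fold_step_div_mod(1)[of i a M] assms by simp
  then show ?thesis using assms(2) by (simp add: div_less_iff_less_mult mult.commute)
qed

lemma fold_step_inj:
  assumes "1 \<le> i" "1 \<le> i'" "a < M" "a' < M" "fold_step M i a = fold_step M i' a'"
  shows "i = i' \<and> a = a'"
proof -
  have "i - 1 = i' - 1"
    using fold_step_div_mod(1)[OF assms(1,3)] fold_step_div_mod(1)[OF assms(2,4)] assms(5) by simp
  then have i: "i = i'" using assms(1,2) by simp
  have "(if odd i then a else M - 1 - a) = (if odd i then a' else M - 1 - a')"
    using fold_step_div_mod(2)[OF assms(1,3)] fold_step_div_mod(2)[OF assms(2,4)] assms(5) i by simp
  then show ?thesis using i assms(3,4) by (auto split: if_splits)
qed

primrec fold_index :: "nat \<Rightarrow> nat list \<Rightarrow> nat" where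
  "fold_index N [] = 0"
| "fold_index N (i # is) = fold_step (N ^ length is) i (fold_index N is)"

lemma fold_index_less:
  "set is \<subseteq> {1..N} \<Longrightarrow> fold_index N is < N ^ length is"
  by (induction "is") (auto intro!: fold_step_less)

text \<open>
  The outermost letter and the index of the tail can be read off from the quotient and the remainder
  modulo \<open>N ^ length is\<close>. Hence distinct words of the same length have distinct cells, which
  bounds the number of cylinders that meet a given cube.
\<close>
lemma fold_index_inj:
  assumes "set is \<subseteq> {1..N}" "set js \<subseteq> {1..N}" "length is = length js"
    "fold_index N is = fold_index N js"
  shows "is = js"
  using assms(3,1,2,4)
proof (induction "is" js rule: list_induct2)
  case (Cons i "is" j js)
  have "i = j \<and> fold_index N is = fold_index N js"
    by (rule fold_step_inj[of _ _ _ "N ^ length is"])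
      (use Cons fold_index_less[of "is" N] fold_index_less[of js N] in auto)
  with Cons show ?case by auto
qed simp

lemma folding_map_eq:
  assumes "uniform_partition N x" "i \<in> {1..N}"
  shows "folding_map N x i t = x 0 +
    (if odd i then real (i - 1) * ((x N - x 0) / N) + (t - x 0) / N
     else real i * ((x N - x 0) / N) - (t - x 0) / N)"
proof -
  define d where "d = (x N - x 0) / real N"
  have less: "x 0 < x N" using assms by (intro uniform_partition_less) auto
  have d: "d * ((t - x 0) / (x N - x 0)) = (t - x 0) / N"
    using less by (simp add: d_def)
  have gap: "x i - x (i - 1) = d"
    using assms by (simp add: uniform_partition_def d_def)
  have swap: "x (i - 1) - x i = - d" using gap by simp
  have pt: "x i = x 0 + real i * d" "x (i - 1) = x 0 + real (i - 1) * d"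
    using uniform_partition_point[OF assms(1), of i] uniform_partition_point[OF assms(1), of "i - 1"] assms(2)
    by (auto simp: d_def)
  have "folding_map N x i t = (if odd i then x (i - 1) + d * ((t - x 0) / (x N - x 0))
      else x i - d * ((t - x 0) / (x N - x 0)))"
    unfolding folding_map_def affine_through_def gap swap by simp
  then show ?thesis by (simp only: d pt) (simp add: d_def)
qed

definition grid_interval :: "nat \<Rightarrow> (nat \<Rightarrow> real) \<Rightarrow> nat \<Rightarrow> nat \<Rightarrow> real set" where
  "grid_interval N x p a =
    {x 0 + real a * ((x N - x 0) / real N ^ p)..x 0 + (real a + 1) * ((x N - x 0) / real N ^ p)}"

lemma grid_interval_0: "grid_interval N x 0 0 = {x 0..x N}"
  by (simp add: grid_interval_def)

lemma grid_interval_subset: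
  assumes "x 0 \<le> x N" "0 < N" "a < N ^ p"
  shows "grid_interval N x p a \<subseteq> {x 0..x N}"
proof -
  have "real a + 1 \<le> real (N ^ p)" using assms(3) by linarith
  then have "real a + 1 \<le> real N ^ p" by simp
  then have "(real a + 1) * ((x N - x 0) / real N ^ p) \<le> real N ^ p * ((x N - x 0) / real N ^ p)"
    using assms by (intro mult_right_mono) auto
  then have "(real a + 1) * ((x N - x 0) / real N ^ p) \<le> x N - x 0" using assms(2) by simp
  moreover have "0 \<le> real a * ((x N - x 0) / real N ^ p)" using assms by simp
  ultimately show ?thesis by (auto simp: grid_interval_def)
qed

lemma folding_map_grid_interval:
  assumes part: "uniform_partition N x" and i: "i \<in> {1..N}" and a: "a < N ^ p"
    and t: "t \<in> grid_interval N x p a"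
  shows "folding_map N x i t \<in> grid_interval N x (Suc p) (fold_step (N ^ p) i a)"
proof -
  define d where "d = (x N - x 0) / real N ^ Suc p"
  have N: "0 < N" using i by auto
  have d: "(x N - x 0) / real N ^ p = d * N" "(x N - x 0) / N = real N ^ p * d"
    using N by (simp_all add: d_def)
  have t1: "real a * d \<le> (t - x 0) / N" "(t - x 0) / N \<le> (real a + 1) * d"
    using t N by (simp_all add: grid_interval_def d pos_le_divide_eq pos_divide_le_eq mult.assoc algebra_simps)
  have cell: "grid_interval N x (Suc p) c = {x 0 + real c * d..x 0 + (real c + 1) * d}" for c
    by (simp add: grid_interval_def d_def del: power_Suc)
  have fold: "folding_map N x i t = x 0 + (if odd i then real (i - 1) * (real N ^ p * d) + (t - x 0) / N
     else real i * (real N ^ p * d) - (t - x 0) / N)"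
    by (simp only: folding_map_eq[OF part i] d(2))
  show ?thesis
  proof (cases "odd i")
    case True
    have "real (fold_step (N ^ p) i a) = real (i - 1) * real N ^ p + real a"
      using True by (simp add: fold_step_def)
    then show ?thesis using True t1 unfolding cell fold by (simp add: algebra_simps)
  next
    case False
    have "1 * N ^ p \<le> i * N ^ p" using i by (intro mult_le_mono1) auto
    then have "Suc a \<le> i * N ^ p" using a by linarith
    then have "real (fold_step (N ^ p) i a) = real i * real N ^ p - 1 - real a"
      using False by (simp add: fold_step_def of_nat_diff)
    note cell[of "fold_step (N ^ p) i a", unfolded this]
    then show ?thesis using False t1 unfolding fold by (simp add: algebra_simps)
  qed
qed

lemma dist_folding_map:
  assumes "uniform_partition N x" "i \<in> {1..N}"
  shows "dist (folding_map N x i s) (folding_map N x i t) = dist s t / N"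
  using assms(2) by (auto simp: folding_map_eq[OF assms] dist_real_def field_simps abs_if simp flip: diff_divide_distrib)

locale square_grid =
  fixes N :: nat and x y :: "nat \<Rightarrow> real"
  assumes N2: "2 \<le> N" and x: "uniform_partition N x" and y: "uniform_partition N y"
    and square: "x N - x 0 = y N - y 0"
begin

abbreviation "R \<equiv> rect N x y"
abbreviation "cyl \<equiv> D_word N x y"

definition side :: real where "side = x N - x 0"

lemma N0: "0 < N" using N2 by simp

lemma side_pos: "0 < side"
  using uniform_partition_less[OF x N0] by (simp add: side_def)

lemma L_word_append: "L_word N x y (u @ v) = L_word N x y u \<circ> L_word N x y v"
  by (induction u) (auto simp: L_word_def)

lemma cyl_Nil [simp]: "cyl [] = R"
  by (simp add: D_word_def L_word_def)

lemma cyl_Cons: "cyl (a # w) = L_map N x y a ` cyl w"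
  by (simp add: D_word_def L_word_def image_comp)

lemma mem_rect: "t \<in> R \<longleftrightarrow> fst t \<in> {x 0..x N} \<and> snd t \<in> {y 0..y N}"
  by (cases t) (simp add: rect_def)

lemma cyl_grid_interval:
  assumes "set w \<subseteq> letters N" "t \<in> cyl w"
  shows "fst t \<in> grid_interval N x (length w) (fold_index N (map fst w)) \<and>
    snd t \<in> grid_interval N y (length w) (fold_index N (map snd w))"
  using assms
proof (induction w arbitrary: t)
  case Nil
  then show ?case by (simp add: grid_interval_0 mem_rect del: atLeastAtMost_iff)
next
  case (Cons l w)
  obtain i j where l: "l = (i, j)" by fastforce
  have ij: "i \<in> {1..N}" "j \<in> {1..N}" using Cons.prems(1) by (auto simp: l letters_def)
  have w: "set (map fst w) \<subseteq> {1..N}" "set (map snd w) \<subseteq> {1..N}"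
    using Cons.prems(1) by (force simp: letters_def)+
  obtain t' where t': "t' \<in> cyl w" "t = L_map N x y l t'"
    using Cons.prems(2) by (auto simp: cyl_Cons)
  have "fst t = folding_map N x i (fst t')" "snd t = folding_map N y j (snd t')"
    by (simp_all add: t' L_map_def l case_prod_unfold)
  then show ?case
    using folding_map_grid_interval[OF x ij(1) fold_index_less[OF w(1)], of "fst t'"]
      folding_map_grid_interval[OF y ij(2) fold_index_less[OF w(2)], of "snd t'"]
      Cons.IH[OF _ t'(1)] Cons.prems(1) by (simp add: l)
qed

lemma cyl_subset_rect:
  assumes "set w \<subseteq> letters N"
  shows "cyl w \<subseteq> R"
proof
  fix t assume "t \<in> cyl w"
  from cyl_grid_interval[OF assms this]
  have "fst t \<in> grid_interval N x (length w) (fold_index N (map fst w))"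
    "snd t \<in> grid_interval N y (length w) (fold_index N (map snd w))" by auto
  moreover have "fold_index N (map fst w) < N ^ length w" "fold_index N (map snd w) < N ^ length w"
    using assms fold_index_less[of "map fst w" N] fold_index_less[of "map snd w" N]
    by (force simp: letters_def)+
  ultimately show "t \<in> R"
    using grid_interval_subset[of x N, OF _ N0] grid_interval_subset[of y N, OF _ N0] side_pos square
    unfolding mem_rect side_def by (metis diff_gt_0_iff_gt less_imp_le subsetD)
qed

lemma cyl_append_subset:
  assumes "set u \<subseteq> letters N"
  shows "cyl (w @ u) \<subseteq> cyl w"
proof -
  have "cyl (w @ u) = L_word N x y w ` cyl u"
    by (simp add: D_word_def L_word_append image_comp)
  also have "\<dots> \<subseteq> cyl w" using cyl_subset_rect[OF assms] by (auto simp: D_word_def)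
  finally show ?thesis .
qed

lemma rect_ne: "R \<noteq> {}"
  using side_pos square by (auto simp: rect_def side_def)

lemma cyl_ne: "cyl w \<noteq> {}"
  using rect_ne by (simp add: D_word_def)

lemma dist_L_map:
  assumes "a \<in> letters N"
  shows "dist (L_map N x y a s) (L_map N x y a t) = dist s t / N"
proof -
  obtain i j where a: "a = (i, j)" "i \<in> {1..N}" "j \<in> {1..N}" using assms by (auto simp: letters_def)
  have *: "dist (L_map N x y a s) (L_map N x y a t) =
    sqrt (((dist (fst s) (fst t))\<^sup>2 + (dist (snd s) (snd t))\<^sup>2) / (real N)\<^sup>2)"
    by (simp add: a L_map_def case_prod_unfold dist_prod_def dist_folding_map[OF x a(2)]
        dist_folding_map[OF y a(3)] power_divide add_divide_distrib)
  show ?thesis using N0 unfolding * real_sqrt_divide by (simp add: dist_prod_def)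
qed

lemma dist_cyl_le:
  assumes "set w \<subseteq> letters N" "s \<in> cyl w" "t \<in> cyl w"
  shows "dist s t \<le> 2 * side / real N ^ length w"
  using assms
proof (induction w arbitrary: s t)
  case Nil
  have "dist s t \<le> dist (fst s) (fst t) + dist (snd s) (snd t)"
    by (simp add: dist_prod_def sqrt_sum_squares_le_sum)
  also have "\<dots> \<le> side + side"
    using Nil square by (intro add_mono) (auto simp: mem_rect side_def dist_real_def)
  finally show ?case by simp
next
  case (Cons a w)
  then obtain s' t' where "s' \<in> cyl w" "s = L_map N x y a s'" "t' \<in> cyl w" "t = L_map N x y a t'"
    by (auto simp: cyl_Cons)
  then show ?case using Cons N0 by (auto simp: dist_L_map field_simps)
qed

lemma continuous_L_map:
  assumes "a \<in> letters N"
  shows "continuous_on X (L_map N x y a)"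
proof -
  have "(1 / real N)-lipschitz_on X (L_map N x y a)"
    by (rule lipschitz_onI) (auto simp: dist_L_map[OF assms])
  then show ?thesis by (rule lipschitz_on_continuous_on)
qed

lemma connected_cyl:
  assumes "set w \<subseteq> letters N"
  shows "connected (cyl w)"
  using assms
proof (induction w)
  case Nil
  then show ?case by (auto simp: rect_def intro!: connected_Times)
next
  case (Cons a w)
  then show ?case unfolding cyl_Cons
    by (intro connected_continuous_image continuous_L_map) auto
qed

end

section \<open>Scaling factors and oscillation of the surface\<close>

locale affine_surface = square_grid +
  fixes S q f :: "real \<times> real \<Rightarrow> real" and lamS lamq :: real
  assumes f_cont: "continuous_on R f"
    and f_graph: "surface_graph R f = (\<Union>a\<in>letters N. Psi_map N x y S q a ` surface_graph R f)"
    and S_less_1: "\<And>t. t \<in> R \<Longrightarrow> \<bar>S t\<bar> < 1"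
    and S_lipschitz: "lamS-lipschitz_on R S"
    and q_lipschitz: "lamq-lipschitz_on R q"
    and S_sign: "(\<forall>t\<in>R. S t > 0) \<or> (\<forall>t\<in>R. S t < 0)"
begin

lemma functional_equation:
  assumes "a \<in> letters N" "t \<in> R"
  shows "f (L_map N x y a t) = S (L_map N x y a t) * f t + q (L_map N x y a t)"
proof -
  obtain i j where a: "a = (i, j)" by fastforce
  obtain b c where t: "t = (b, c)" by fastforce
  have "(b, c, f t) \<in> surface_graph R f" using assms(2) by (auto simp: surface_graph_def t)
  then have "Psi_map N x y S q a (b, c, f t) \<in> surface_graph R f"
    using assms(1) by (subst f_graph) blast
  then show ?thesis
    by (simp add: surface_graph_def Psi_map_def F_map_def L_map_def a t)
qed

lemma rect_covered: "R \<subseteq> (\<Union>a\<in>letters N. L_map N x y a ` R)"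
proof
  fix t assume t: "t \<in> R"
  obtain b c where bc: "t = (b, c)" by fastforce
  have "(b, c, f t) \<in> (\<Union>a\<in>letters N. Psi_map N x y S q a ` surface_graph R f)"
    using t by (subst f_graph[symmetric]) (auto simp: surface_graph_def bc)
  then obtain a z where a: "a \<in> letters N" and z: "z \<in> surface_graph R f"
    and eq: "(b, c, f t) = Psi_map N x y S q a z" by blast
  obtain b' c' where "z = (b', c', f (b', c'))" "(b', c') \<in> R"
    using z by (auto simp: surface_graph_def)
  moreover obtain i j where "a = (i, j)" by fastforce
  ultimately have "t = L_map N x y a (b', c')" "(b', c') \<in> R"
    using eq by (simp_all add: bc Psi_map_def L_map_def)
  then show "t \<in> (\<Union>a\<in>letters N. L_map N x y a ` R)" using a by blast
qed

lemma rect_covered_by_cylinders: "R \<subseteq> (\<Union>w\<in>words N p. cyl w)"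
proof (induction p)
  case (Suc p)
  show ?case
  proof
    fix t assume "t \<in> R"
    then obtain a t' where a: "a \<in> letters N" "t' \<in> R" "t = L_map N x y a t'"
      using rect_covered by blast
    then obtain w where "w \<in> words N p" "t' \<in> cyl w" using Suc by blast
    then have "a # w \<in> words N (Suc p)" "t \<in> cyl (a # w)"
      using a by (auto simp: words_def cyl_Cons)
    then show "t \<in> (\<Union>w\<in>words N (Suc p). cyl w)" by blast
  qed
qed simp

abbreviation "\<sigma> \<equiv> s_upper N x y S"
abbreviation "\<sigma>' \<equiv> s_lower N x y S"

lemma lamS: "0 \<le> lamS" and lamq: "0 \<le> lamq"
  using S_lipschitz q_lipschitz by (auto simp: lipschitz_on_def)

lemma compact_rect: "compact R"
  by (simp add: rect_def compact_Times)

definition S_min :: real where "S_min = (INF t\<in>R. \<bar>S t\<bar>)"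

lemma S_min: "0 < S_min" "t \<in> R \<Longrightarrow> S_min \<le> \<bar>S t\<bar>"
proof -
  have "continuous_on R (\<lambda>t. \<bar>S t\<bar>)"
    using lipschitz_on_continuous_on[OF S_lipschitz] by (intro continuous_intros)
  from continuous_attains_inf[OF compact_rect rect_ne this]
  obtain t0 where t0: "t0 \<in> R" "\<And>t. t \<in> R \<Longrightarrow> \<bar>S t0\<bar> \<le> \<bar>S t\<bar>" by auto
  then have "\<bar>S t0\<bar> \<le> S_min" unfolding S_min_def using rect_ne by (intro cINF_greatest)
  moreover have "0 < \<bar>S t0\<bar>" using S_sign t0(1) by auto
  ultimately show "0 < S_min" by linarith
  show "S_min \<le> \<bar>S t\<bar>" if "t \<in> R"
    unfolding S_min_def using that by (intro cINF_lower bdd_belowI2[of _ 0]) auto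
qed

lemma abs_S_le_upper:
  assumes "set w \<subseteq> letters N" "t \<in> cyl w"
  shows "\<bar>S t\<bar> \<le> \<sigma> w"
  unfolding s_upper_def
  by (intro cSUP_upper assms(2) bdd_aboveI2[of _ _ 1] less_imp_le[OF S_less_1]
      subsetD[OF cyl_subset_rect[OF assms(1)]])

lemma upper_le:
  assumes "\<And>t. t \<in> cyl w \<Longrightarrow> \<bar>S t\<bar> \<le> c"
  shows "\<sigma> w \<le> c"
  unfolding s_upper_def using assms cyl_ne by (intro cSUP_least) auto

lemma lower_le_abs_S:
  assumes "t \<in> cyl w"
  shows "\<sigma>' w \<le> \<bar>S t\<bar>"
  unfolding s_lower_def using assms by (intro cINF_lower bdd_belowI2[of _ 0]) auto

lemma lower_nonneg: "0 \<le> \<sigma>' w"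
  unfolding s_lower_def using cyl_ne by (intro cINF_greatest) auto

definition K :: real where "K = 2 * lamS * side / S_min"

lemma K_nonneg: "0 \<le> K"
  using lamS side_pos S_min by (simp add: K_def)

lemma S_variation:
  assumes "set w \<subseteq> letters N" "s \<in> cyl w" "t \<in> cyl w"
  shows "\<bar>S s - S t\<bar> \<le> lamS * (2 * side / real N ^ length w)"
proof -
  have "\<bar>S s - S t\<bar> \<le> lamS * dist s t"
    using lipschitz_onD[OF S_lipschitz, of s t] cyl_subset_rect[OF assms(1)] assms
    by (auto simp: dist_real_def)
  also have "\<dots> \<le> lamS * (2 * side / real N ^ length w)"
    using dist_cyl_le[OF assms] lamS by (intro mult_left_mono)
  finally show ?thesis .
qed

lemma S_ratio:
  assumes w: "set w \<subseteq> letters N" "s \<in> cyl w" "t \<in> cyl w"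
  shows "\<bar>S s\<bar> \<le> (1 + K / real N ^ length w) * \<bar>S t\<bar>"
proof -
  have t: "S_min \<le> \<bar>S t\<bar>" using cyl_subset_rect[OF w(1)] w(3) by (intro S_min(2)) blast
  have "\<bar>S s\<bar> \<le> \<bar>S t\<bar> + lamS * (2 * side / real N ^ length w)"
    using S_variation[OF w] by linarith
  also have "lamS * (2 * side / real N ^ length w) = K / real N ^ length w * S_min"
    using S_min(1) by (simp add: K_def)
  also have "\<dots> \<le> K / real N ^ length w * \<bar>S t\<bar>"
    using t K_nonneg by (intro mult_left_mono) auto
  finally show ?thesis by (simp add: algebra_simps)
qed

sublocale cylinder_weight N \<sigma> S_min K
proof
  fix w u assume w: "set w \<subseteq> letters N"
  obtain t where t: "t \<in> cyl w" using cyl_ne by blast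
  show "S_min \<le> \<sigma> w"
    using S_min(2)[of t] abs_S_le_upper[OF w t] cyl_subset_rect[OF w] t by fastforce
  show "\<sigma> w \<le> 1"
    by (intro upper_le less_imp_le[OF S_less_1] subsetD[OF cyl_subset_rect[OF w]])
  assume u: "set u \<subseteq> letters N"
  have wu: "set (w @ u) \<subseteq> letters N" using w u by simp
  note sub = cyl_append_subset[OF u, of w]
  show "\<sigma> (w @ u) \<le> \<sigma> w"
    using sub by (intro upper_le abs_S_le_upper[OF w]) auto
  obtain t' where t': "t' \<in> cyl (w @ u)" using cyl_ne by blast
  show "\<sigma> w \<le> (1 + K / real N ^ length w) * \<sigma> (w @ u)"
  proof (rule upper_le)
    fix t assume "t \<in> cyl w"
    then have "\<bar>S t\<bar> \<le> (1 + K / real N ^ length w) * \<bar>S t'\<bar>"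
      using t' sub by (intro S_ratio w) auto
    also have "\<dots> \<le> (1 + K / real N ^ length w) * \<sigma> (w @ u)"
      using abs_S_le_upper[OF wu t'] K_nonneg by (intro mult_left_mono) auto
    finally show "\<bar>S t\<bar> \<le> (1 + K / real N ^ length w) * \<sigma> (w @ u)" .
  qed
qed (use N2 S_min K_nonneg in auto)

text \<open>
  On a cylinder the infimum and the supremum of \<open>\<bar>S\<bar>\<close> differ by the distortion factor only, so both
  sequences of spectral radii converge to the growth rate of the upper scaling factors.
\<close>
lemma rho_S_eq: "rho_S N x y S = growth_rate"
proof -
  have lower: "(\<lambda>n. spectral_radius (M_lower N x y S n)) \<longlonglongrightarrow> growth_rate"
    unfolding M_lower_def
  proof (rule spectral_radius_lower_tendsto[OF lower_nonneg])
    fix w u assume w: "set w \<subseteq> letters N" and u: "set u \<subseteq> letters N"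
    obtain t where t: "t \<in> cyl (w @ u)" using cyl_ne by blast
    then have "t \<in> cyl w" using cyl_append_subset[OF u] by blast
    then have "\<sigma>' w \<le> \<bar>S t\<bar>" by (rule lower_le_abs_S)
    also have "\<dots> \<le> \<sigma> (w @ u)" using w u t by (intro abs_S_le_upper) auto
    finally show "\<sigma>' w \<le> \<sigma> (w @ u)" .
  next
    fix w assume w: "set w \<subseteq> letters N"
    let ?c = "1 + K / real N ^ length w"
    have c: "0 < ?c" using K_nonneg by (intro add_pos_nonneg) auto
    have "\<sigma> w / ?c \<le> \<sigma>' w"
      unfolding s_lower_def
    proof (intro cINF_greatest cyl_ne)
      fix t assume "t \<in> cyl w"
      then have "\<sigma> w \<le> ?c * \<bar>S t\<bar>" by (intro upper_le S_ratio w)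
      then show "\<sigma> w / ?c \<le> \<bar>S t\<bar>" using c by (simp only: pos_divide_le_eq mult.commute)
    qed
    then show "\<sigma> w \<le> ?c * \<sigma>' w" using c by (simp only: pos_divide_le_eq mult.commute)
  qed
  have upper: "(\<lambda>n. spectral_radius (M_upper N x y S n)) \<longlonglongrightarrow> growth_rate"
    unfolding M_upper_def by (rule spectral_radius_upper_tendsto)
  show ?thesis unfolding rho_S_def
  proof (rule the_equality)
    fix r
    assume "(\<lambda>n. spectral_radius (M_lower N x y S n)) \<longlonglongrightarrow> r \<and>
      (\<lambda>n. spectral_radius (M_upper N x y S n)) \<longlonglongrightarrow> r"
    then show "r = growth_rate" using LIMSEQ_unique[OF _ upper] by blast
  qed (intro conjI lower upper)
qed

lemma f_bounded: obtains B where "0 \<le> B" "\<And>t. t \<in> R \<Longrightarrow> \<bar>f t\<bar> \<le> B"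
proof -
  have "bounded (f ` R)"
    by (intro compact_imp_bounded compact_continuous_image f_cont compact_rect)
  then obtain B where "\<And>t. t \<in> R \<Longrightarrow> \<bar>f t\<bar> \<le> B" by (auto simp: bounded_iff)
  moreover have "0 \<le> B" using rect_ne calculation by (meson abs_ge_zero ex_in_conv order_trans)
  ultimately show thesis by (rule that[rotated])
qed

lemma diff_le_osc:
  assumes "E \<subseteq> R" "s \<in> E" "t \<in> E"
  shows "f s - f t \<le> osc f E"
  unfolding osc_def
proof (rule cSup_upper)
  obtain B where B: "\<And>t. t \<in> R \<Longrightarrow> \<bar>f t\<bar> \<le> B" using f_bounded by metis
  have "f s - f t \<le> 2 * B" if "s \<in> E" "t \<in> E" for s t
  proof -
    have "\<bar>f s\<bar> \<le> B" "\<bar>f t\<bar> \<le> B" using that assms(1) by (blast intro: B)+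
    then show ?thesis by linarith
  qed
  then show "bdd_above {f t' - f t'' |t' t''. t' \<in> E \<and> t'' \<in> E}"
    by (intro bdd_aboveI[of _ "2 * B"]) auto
qed (use assms in blast)

lemma osc_le:
  assumes "E \<noteq> {}" "\<And>s t. s \<in> E \<Longrightarrow> t \<in> E \<Longrightarrow> f s - f t \<le> c"
  shows "osc f E \<le> c"
  unfolding osc_def
proof (rule cSup_least)
  show "{f t' - f t'' |t' t''. t' \<in> E \<and> t'' \<in> E} \<noteq> {}" using assms(1) by blast
qed (use assms(2) in blast)

text \<open>
  Subtract the functional equation at two points of the cylinder. On the cylinder of \<open>a # w\<close> the
  function \<open>S\<close> is within a multiple of the diameter of the constant \<open>\<plusminus> \<sigma> (a # w)\<close>; since \<open>f\<close> is bounded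
  and \<open>q\<close> is Lipschitz, all deviations from exact scaling are of the order of the diameter. A sign
  only exchanges the roles of the two points.
\<close>
lemma oscillation_recursion:
  assumes B: "0 \<le> B" "\<And>t. t \<in> R \<Longrightarrow> \<bar>f t\<bar> \<le> B"
    and a: "a \<in> letters N" and w: "set w \<subseteq> letters N"
  shows "\<bar>osc f (cyl (a # w)) - \<sigma> (a # w) * osc f (cyl w)\<bar>
    \<le> (2 * B * lamS + lamq) * (2 * side) / real N ^ length w"
proof -
  have aw: "set (a # w) \<subseteq> letters N" using a w by simp
  let ?\<delta> = "2 * side / real N ^ length w" and ?s = "\<sigma> (a # w)" and ?L = "L_map N x y a"
  let ?E = "(2 * B * lamS + lamq) * ?\<delta>"
  have \<delta>: "2 * side / real N ^ length (a # w) \<le> ?\<delta>"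
    using side_pos N0 by (intro divide_left_mono) auto
  have s: "0 < ?s" by (rule pos[OF aw])
  obtain e where e: "e = 1 \<or> e = -1" "\<And>t. t \<in> R \<Longrightarrow> S t = e * \<bar>S t\<bar>"
  proof (cases "\<forall>t\<in>R. S t > 0")
    case True
    show thesis by (rule that[of 1]) (use True in \<open>simp_all add: abs_of_pos\<close>)
  next
    case False
    then have "\<forall>t\<in>R. S t < 0" using S_sign by blast
    then show thesis by (intro that[of "-1"]) (simp_all add: abs_of_neg)
  qed
  have S_near: "\<bar>S t - e * ?s\<bar> \<le> lamS * ?\<delta>" if t: "t \<in> cyl (a # w)" for t
  proof -
    have "\<bar>S t\<bar> \<le> ?s" by (rule abs_S_le_upper[OF aw t])
    moreover have "?s \<le> \<bar>S t\<bar> + lamS * ?\<delta>"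
    proof (rule upper_le)
      fix t' assume t': "t' \<in> cyl (a # w)"
      have "\<bar>S t' - S t\<bar> \<le> lamS * (2 * side / real N ^ length (a # w))"
        by (rule S_variation[OF aw t' t])
      also have "\<dots> \<le> lamS * ?\<delta>" using \<delta> lamS by (rule mult_left_mono)
      finally show "\<bar>S t'\<bar> \<le> \<bar>S t\<bar> + lamS * ?\<delta>" by linarith
    qed
    moreover have "S t = e * \<bar>S t\<bar>" using e(2) t cyl_subset_rect[OF aw] by blast
    ultimately show ?thesis using e(1) by (auto simp: abs_if split: if_splits)
  qed
  have key: "\<bar>(f (?L t') - f (?L t'')) - e * ?s * (f t' - f t'')\<bar> \<le> ?E"
    if t: "t' \<in> cyl w" "t'' \<in> cyl w" for t' t''
  proof -
    have R: "t' \<in> R" "t'' \<in> R" using t cyl_subset_rect[OF w] by auto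
    have L: "?L t' \<in> cyl (a # w)" "?L t'' \<in> cyl (a # w)" using t by (auto simp: cyl_Cons)
    have LR: "?L t' \<in> R" "?L t'' \<in> R" using L cyl_subset_rect[OF aw] by auto
    have 1: "\<bar>(S (?L t') - e * ?s) * f t'\<bar> \<le> (lamS * ?\<delta>) * B"
      unfolding abs_mult using S_near[OF L(1)] B(2)[OF R(1)] by (intro mult_mono) auto
    have 2: "\<bar>(S (?L t'') - e * ?s) * f t''\<bar> \<le> (lamS * ?\<delta>) * B"
      unfolding abs_mult using S_near[OF L(2)] B(2)[OF R(2)] by (intro mult_mono) auto
    have "\<bar>q (?L t') - q (?L t'')\<bar> \<le> lamq * dist (?L t') (?L t'')"
      using lipschitz_onD[OF q_lipschitz LR] by (simp add: dist_real_def)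
    also have "\<dots> \<le> lamq * ?\<delta>"
      using dist_cyl_le[OF aw L] \<delta> lamq by (intro mult_left_mono) auto
    finally have 3: "\<bar>q (?L t') - q (?L t'')\<bar> \<le> lamq * ?\<delta>" .
    have "(f (?L t') - f (?L t'')) - e * ?s * (f t' - f t'') =
      (S (?L t') - e * ?s) * f t' - (S (?L t'') - e * ?s) * f t'' + (q (?L t') - q (?L t''))"
      by (simp add: functional_equation[OF a] R algebra_simps)
    moreover have "?E = (lamS * ?\<delta>) * B + (lamS * ?\<delta>) * B + lamq * ?\<delta>"
      by (simp add: algebra_simps add_divide_distrib)
    ultimately show ?thesis using 1 2 3 by linarith
  qed
  have "osc f (cyl (a # w)) \<le> ?s * osc f (cyl w) + ?E"
  proof (rule osc_le[OF cyl_ne])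
    fix t1 t2 assume "t1 \<in> cyl (a # w)" "t2 \<in> cyl (a # w)"
    then obtain t' t'' where t: "t' \<in> cyl w" "t'' \<in> cyl w" "t1 = ?L t'" "t2 = ?L t''"
      by (auto simp: cyl_Cons)
    have "e * (f t' - f t'') \<le> osc f (cyl w)"
      using e(1) diff_le_osc[OF cyl_subset_rect[OF w] t(1,2)] diff_le_osc[OF cyl_subset_rect[OF w] t(2,1)]
      by auto
    then have "?s * (e * (f t' - f t'')) \<le> ?s * osc f (cyl w)" using s by (intro mult_left_mono) auto
    moreover have "?s * (e * (f t' - f t'')) = e * ?s * (f t' - f t'')" by simp
    ultimately show "f t1 - f t2 \<le> ?s * osc f (cyl w) + ?E"
      using key[OF t(1,2)] unfolding t(3,4) by linarith
  qed
  moreover have "osc f (cyl w) \<le> (osc f (cyl (a # w)) + ?E) / ?s"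
  proof (rule osc_le[OF cyl_ne])
    fix t' t'' assume t: "t' \<in> cyl w" "t'' \<in> cyl w"
    have L: "?L t' \<in> cyl (a # w)" "?L t'' \<in> cyl (a # w)" using t by (auto simp: cyl_Cons)
    note d = diff_le_osc[OF cyl_subset_rect[OF aw] L] diff_le_osc[OF cyl_subset_rect[OF aw] L(2,1)]
    have "?s * (f t' - f t'') \<le> osc f (cyl (a # w)) + ?E"
      using e(1) key[OF t] d by auto
    then show "f t' - f t'' \<le> (osc f (cyl (a # w)) + ?E) / ?s"
      using s by (simp add: pos_le_divide_eq mult.commute)
  qed
  then have "?s * osc f (cyl w) \<le> osc f (cyl (a # w)) + ?E"
    using s by (simp add: pos_le_divide_eq mult.commute)
  ultimately have "\<bar>osc f (cyl (a # w)) - ?s * osc f (cyl w)\<bar> \<le> ?E" by linarith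
  then show ?thesis by simp
qed

lemma osc_nonneg:
  assumes "set w \<subseteq> letters N"
  shows "0 \<le> osc f (cyl w)"
proof -
  obtain t where "t \<in> cyl w" using cyl_ne by blast
  with diff_le_osc[OF cyl_subset_rect[OF assms], of t t] show ?thesis by simp
qed

lemma osc_sum_nonneg: "0 \<le> osc_sum N x y f p"
  unfolding osc_sum_def by (intro sum_nonneg osc_nonneg) (simp add: words_def)

lemma
  shows osc_sum_le_power: "\<lbrakk>growth_rate < \<tau>; real N < \<tau>\<rbrakk> \<Longrightarrow>
      \<exists>C. \<forall>p. osc_sum N x y f p \<le> C * \<tau> ^ p"
    and power_le_osc_sum: "\<lbrakk>real N < \<tau>; \<tau> < growth_rate; \<And>T. \<exists>p. T * real N ^ p < osc_sum N x y f p\<rbrakk> \<Longrightarrow>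
      \<exists>c>0. \<exists>p0. \<forall>p\<ge>p0. c * \<tau> ^ p \<le> osc_sum N x y f p"
proof -
  obtain B where B: "0 \<le> B" "\<And>t. t \<in> R \<Longrightarrow> \<bar>f t\<bar> \<le> B" using f_bounded by metis
  interpret osc: oscillation_system N \<sigma> S_min K "\<lambda>w. osc f (cyl w)" "(2 * B * lamS + lamq) * (2 * side)"
  proof
    show "0 \<le> (2 * B * lamS + lamq) * (2 * side)"
      using B(1) lamS lamq side_pos by simp
  qed (simp_all only: osc_nonneg oscillation_recursion[OF B])
  have eq: "osc_sum N x y f p = osc.osc_total p" for p
    by (simp add: osc_sum_def osc.osc_total_def)
  show "\<exists>C. \<forall>p. osc_sum N x y f p \<le> C * \<tau> ^ p" if "growth_rate < \<tau>" "real N < \<tau>"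
    unfolding eq by (rule osc.osc_total_le_power[OF that])
  show "\<exists>c>0. \<exists>p0. \<forall>p\<ge>p0. c * \<tau> ^ p \<le> osc_sum N x y f p"
    if "real N < \<tau>" "\<tau> < growth_rate" "\<And>T. \<exists>p. T * real N ^ p < osc_sum N x y f p"
    using that unfolding eq by (rule osc.power_le_osc_total)
qed

end

section \<open>Counting mesh cubes\<close>

text \<open>
  Multiplicative constants disappear in the quotient of logarithms as \<open>\<epsilon>\<close> tends to 0. The bound \<open>s0\<close>
  confines the lower estimate to exponents close to \<open>d\<close>.
\<close>
lemma has_box_dimI:
  fixes E :: "'a::euclidean_space set" and d s0 :: real
  assumes upper: "\<And>s. d < s \<Longrightarrow>
      \<exists>C. \<forall>\<^sub>F \<epsilon> in at_right 0. real (card (grid_cubes \<epsilon> E)) \<le> C * (1 / \<epsilon>) powr s"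
    and s0: "s0 < d"
    and lower: "\<And>s. s0 < s \<Longrightarrow> s < d \<Longrightarrow>
      \<exists>c>0. \<forall>\<^sub>F \<epsilon> in at_right 0. c * (1 / \<epsilon>) powr s \<le> real (card (grid_cubes \<epsilon> E))"
  shows "has_box_dim E d"
proof -
  let ?n = "\<lambda>\<epsilon>. real (card (grid_cubes \<epsilon> E))"
  have ln_top: "filterlim (\<lambda>\<epsilon>::real. ln (1 / \<epsilon>)) at_top (at_right 0)"
  proof -
    have lim: "filterlim (\<lambda>\<epsilon>::real. - ln \<epsilon>) at_top (at_right 0)"
      using ln_at_0 by (simp add: filterlim_uminus_at_top)
    have "\<forall>\<^sub>F \<epsilon> in at_right (0::real). - ln \<epsilon> = ln (1 / \<epsilon>)"
      using eventually_at_right_less[of 0] by eventually_elim (simp add: ln_div)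
    from filterlim_cong[OF refl refl this, THEN iffD1, OF lim] show ?thesis .
  qed
  have const: "((\<lambda>\<epsilon>. ln c / ln (1 / \<epsilon>) + s) \<longlongrightarrow> s) (at_right 0)" for c s :: real
    using tendsto_add[OF tendsto_divide_0[OF tendsto_const filterlim_at_top_imp_at_infinity[OF ln_top]]
        tendsto_const[of s], of "ln c"] by simp
  have ln_pos: "\<forall>\<^sub>F \<epsilon> in at_right (0::real). 0 < ln (1 / \<epsilon>)"
    using filterlim_at_top_dense[THEN iffD1, OF ln_top] by blast
  note pos = eventually_at_right_less[of "0::real"]
  have lim: "((\<lambda>\<epsilon>. ln (?n \<epsilon>) / ln (1 / \<epsilon>)) \<longlongrightarrow> d) (at_right 0)"
  proof (rule order_tendstoI)
    fix a assume a: "a < d"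
    define s where "s = (max a s0 + d) / 2"
    have s: "s0 < s" "s < d" "a < s" using a s0 by (auto simp: s_def)
    obtain c where c: "0 < c" "\<forall>\<^sub>F \<epsilon> in at_right 0. c * (1 / \<epsilon>) powr s \<le> ?n \<epsilon>"
      using lower[OF s(1,2)] by blast
    show "\<forall>\<^sub>F \<epsilon> in at_right 0. a < ln (?n \<epsilon>) / ln (1 / \<epsilon>)"
      using c(2) order_tendstoD(1)[OF const[of c s] s(3)] ln_pos pos
    proof eventually_elim
      case (elim \<epsilon>)
      have "0 < c * (1 / \<epsilon>) powr s" using c(1) elim(4) by simp
      then have "ln (c * (1 / \<epsilon>) powr s) \<le> ln (?n \<epsilon>)" using elim(1) by (intro ln_mono) auto
      moreover have "ln (c * (1 / \<epsilon>) powr s) = ln c + s * ln (1 / \<epsilon>)"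
        using c(1) elim(4) by (simp add: ln_mult ln_powr)
      ultimately have "(ln c + s * ln (1 / \<epsilon>)) / ln (1 / \<epsilon>) \<le> ln (?n \<epsilon>) / ln (1 / \<epsilon>)"
        using elim(3) by (intro divide_right_mono) auto
      then have "ln c / ln (1 / \<epsilon>) + s \<le> ln (?n \<epsilon>) / ln (1 / \<epsilon>)"
        using elim(3) by (simp add: add_divide_distrib)
      with elim(2) show ?case by linarith
    qed
  next
    fix a assume a: "d < a"
    define s where "s = (d + a) / 2"
    have s: "d < s" "s < a" using a by (auto simp: s_def)
    obtain C where C: "\<forall>\<^sub>F \<epsilon> in at_right 0. ?n \<epsilon> \<le> C * (1 / \<epsilon>) powr s"
      using upper[OF s(1)] by blast
    define s' where "s' = (s0 + d) / 2"
    have s': "s0 < s'" "s' < d" using s0 by (auto simp: s'_def)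
    obtain c where c: "0 < c" "\<forall>\<^sub>F \<epsilon> in at_right 0. c * (1 / \<epsilon>) powr s' \<le> ?n \<epsilon>"
      using lower[OF s'] by blast
    show "\<forall>\<^sub>F \<epsilon> in at_right 0. ln (?n \<epsilon>) / ln (1 / \<epsilon>) < a"
      using C c(2) order_tendstoD(2)[OF const[of C s] s(2)] ln_pos pos
    proof eventually_elim
      case (elim \<epsilon>)
      have "0 < c * (1 / \<epsilon>) powr s'" using c(1) elim(5) by simp
      then have n: "0 < ?n \<epsilon>" using elim(2) by linarith
      then have "0 < C * (1 / \<epsilon>) powr s" using elim(1) by linarith
      then have C: "0 < C" by (simp add: zero_less_mult_iff)
      have "ln (?n \<epsilon>) \<le> ln (C * (1 / \<epsilon>) powr s)" using n elim(1) by (intro ln_mono) auto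
      also have "\<dots> = ln C + s * ln (1 / \<epsilon>)"
        using C elim(5) by (simp add: ln_mult ln_powr)
      finally have "ln (?n \<epsilon>) / ln (1 / \<epsilon>) \<le> (ln C + s * ln (1 / \<epsilon>)) / ln (1 / \<epsilon>)"
        using elim(4) by (intro divide_right_mono) auto
      then have "ln (?n \<epsilon>) / ln (1 / \<epsilon>) \<le> ln C / ln (1 / \<epsilon>) + s"
        using elim(4) by (simp add: add_divide_distrib)
      with elim(3) show ?case by linarith
    qed
  qed
  then have lim': "((\<lambda>\<epsilon>. ereal (ln (?n \<epsilon>) / ln (1 / \<epsilon>))) \<longlongrightarrow> ereal d) (at_right 0)" by simp
  have ne: "at_right (0::real) \<noteq> bot" by simp
  show ?thesis
    unfolding has_box_dim_def upper_box_dim_def lower_box_dim_def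
    using lim_imp_Limsup[OF ne lim'] lim_imp_Liminf[OF ne lim'] by simp
qed

definition touches :: "real \<Rightarrow> int \<Rightarrow> real \<Rightarrow> bool" where
  "touches \<epsilon> a s \<longleftrightarrow> \<epsilon> * of_int a \<le> s \<and> s \<le> \<epsilon> * (of_int a + 1)"

definition cube_corners :: "real \<Rightarrow> (real \<times> real \<times> real) set \<Rightarrow> (int \<times> int \<times> int) set" where
  "cube_corners \<epsilon> E = {(a, b, c). \<exists>(r, s, t)\<in>E. touches \<epsilon> a r \<and> touches \<epsilon> b s \<and> touches \<epsilon> c t}"

lemma card_grid_cubes_eq:
  assumes "0 < \<epsilon>"
  shows "card (grid_cubes \<epsilon> E) = card (cube_corners \<epsilon> E)"
proof -
  define corner :: "int \<times> int \<times> int \<Rightarrow> real \<times> real \<times> real"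
    where "corner = (\<lambda>(a, b, c). (of_int a, of_int b, of_int c))"
  define Q where "Q k = cbox (\<epsilon> *\<^sub>R corner k) (\<epsilon> *\<^sub>R (corner k + One))" for k
  have box: "z \<in> cbox (\<epsilon> *\<^sub>R n) (\<epsilon> *\<^sub>R (n + One)) \<longleftrightarrow>
     (\<forall>i\<in>Basis. \<epsilon> * (n \<bullet> i) \<le> z \<bullet> i \<and> z \<bullet> i \<le> \<epsilon> * (n \<bullet> i + 1))" for z n :: "real \<times> real \<times> real"
    by (simp add: mem_box inner_add_left)
  have Q: "(r, s, t) \<in> Q (a, b, c) \<longleftrightarrow> touches \<epsilon> a r \<and> touches \<epsilon> b s \<and> touches \<epsilon> c t" for r s t a b c
    unfolding Q_def box by (auto simp: corner_def Basis_prod_def touches_def)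
  have ne: "Q k \<noteq> {}" for k
    unfolding Q_def box_ne_empty using assms by (simp add: inner_add_left)
  have "inj_on Q (cube_corners \<epsilon> E)"
  proof (rule inj_onI)
    fix k l assume "Q k = Q l"
    then have "\<epsilon> *\<^sub>R corner k = \<epsilon> *\<^sub>R corner l"
      using ne[of k] ne[of l] unfolding Q_def eq_cbox by blast
    then show "k = l" using assms by (auto simp: corner_def split: prod.splits)
  qed
  moreover have "Q ` cube_corners \<epsilon> E = grid_cubes \<epsilon> E"
  proof (intro subset_antisym subsetI)
    fix X assume "X \<in> Q ` cube_corners \<epsilon> E"
    then obtain a b c where X: "X = Q (a, b, c)" "(a, b, c) \<in> cube_corners \<epsilon> E" by auto
    then have "X \<inter> E \<noteq> {}" using Q by (auto simp: cube_corners_def)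
    moreover have "\<forall>i\<in>Basis. corner (a, b, c) \<bullet> i \<in> \<int>"
      by (auto simp: corner_def Basis_prod_def)
    ultimately show "X \<in> grid_cubes \<epsilon> E"
      unfolding grid_cubes_def X Q_def by blast
  next
    fix X assume "X \<in> grid_cubes \<epsilon> E"
    then obtain n where n: "X = cbox (\<epsilon> *\<^sub>R n) (\<epsilon> *\<^sub>R (n + One))" "\<forall>i\<in>Basis. n \<bullet> i \<in> \<int>" "X \<inter> E \<noteq> {}"
      unfolding grid_cubes_def by blast
    obtain n1 n2 n3 where n': "n = (n1, n2, n3)" by (metis prod_cases3)
    have "n1 \<in> \<int>" "n2 \<in> \<int>" "n3 \<in> \<int>"
      using n(2) by (auto simp: n' Basis_prod_def)
    then obtain a b c where "n = corner (a, b, c)"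
      by (auto simp: n' corner_def elim!: Ints_cases)
    then have X: "X = Q (a, b, c)" by (simp add: n(1) Q_def)
    moreover have "(a, b, c) \<in> cube_corners \<epsilon> E"
      using n(3) Q unfolding X by (force simp: cube_corners_def)
    ultimately show "X \<in> Q ` cube_corners \<epsilon> E" by blast
  qed
  ultimately have "bij_betw Q (cube_corners \<epsilon> E) (grid_cubes \<epsilon> E)" by (simp add: bij_betw_def)
  then show ?thesis by (simp add: bij_betw_same_card)
qed

lemma finite_card_int_interval:
  fixes u v :: real
  shows "finite {k::int. u \<le> of_int k \<and> of_int k \<le> v}"
    and "u \<le> v \<Longrightarrow> real (card {k::int. u \<le> of_int k \<and> of_int k \<le> v}) \<le> v - u + 1"
proof -
  have eq: "{k::int. u \<le> of_int k \<and> of_int k \<le> v} = {\<lceil>u\<rceil>..\<lfloor>v\<rfloor>}"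
    by (auto simp: ceiling_le_iff le_floor_iff)
  show "finite {k::int. u \<le> of_int k \<and> of_int k \<le> v}" unfolding eq by simp
  assume "u \<le> v"
  then show "real (card {k::int. u \<le> of_int k \<and> of_int k \<le> v}) \<le> v - u + 1"
    unfolding eq by simp linarith
qed

text \<open>
  The intervals are closed, so end points of \<open>[u, v]\<close> on the mesh count twice; this is covered by the
  summand 2.
\<close>
lemma touching_cells:
  assumes \<epsilon>: "0 < \<epsilon>" and uv: "u \<le> v"
  shows "finite {a. \<exists>s. u \<le> s \<and> s \<le> v \<and> touches \<epsilon> a s}"
    and "real (card {a. \<exists>s. u \<le> s \<and> s \<le> v \<and> touches \<epsilon> a s}) \<le> (v - u) / \<epsilon> + 2"
proof -
  let ?T = "{a. \<exists>s. u \<le> s \<and> s \<le> v \<and> touches \<epsilon> a s}"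
  let ?I = "{k::int. u / \<epsilon> - 1 \<le> of_int k \<and> of_int k \<le> v / \<epsilon>}"
  have sub: "?T \<subseteq> ?I"
  proof
    fix a assume "a \<in> ?T"
    then obtain s where "u \<le> s" "s \<le> v" "touches \<epsilon> a s" by blast
    then have "u \<le> \<epsilon> * (of_int a + 1)" "\<epsilon> * of_int a \<le> v" by (auto simp: touches_def)
    then show "a \<in> ?I" using \<epsilon> by (simp add: field_simps)
  qed
  then show "finite ?T" using finite_card_int_interval(1) by (rule finite_subset)
  have "real (card ?T) \<le> real (card ?I)"
    using sub finite_card_int_interval(1) by (simp add: card_mono)
  also have "\<dots> \<le> v / \<epsilon> - (u / \<epsilon> - 1) + 1"
    using \<epsilon> uv by (intro finite_card_int_interval(2)) (simp add: divide_right_mono add_increasing2 diff_le_eq)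
  finally show "real (card ?T) \<le> (v - u) / \<epsilon> + 2" by (simp add: diff_divide_distrib)
qed

lemma grid_intervals_touched:
  assumes \<epsilon>: "0 < \<epsilon>" and len: "\<epsilon> \<le> (x N - x 0) / real N ^ p"
  shows "finite {k. \<exists>s\<in>grid_interval N x p k. touches \<epsilon> a s}"
    and "card {k. \<exists>s\<in>grid_interval N x p k. touches \<epsilon> a s} \<le> 3"
proof -
  define d where "d = (x N - x 0) / real N ^ p"
  have d: "\<epsilon> \<le> d" "0 < d" using assms by (auto simp: d_def)
  let ?T = "{k. \<exists>s\<in>grid_interval N x p k. touches \<epsilon> a s}"
  let ?u = "(\<epsilon> * of_int a - x 0) / d - 1" and ?v = "(\<epsilon> * (of_int a + 1) - x 0) / d"
  let ?I = "{k::int. ?u \<le> of_int k \<and> of_int k \<le> ?v}"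
  have sub: "int ` ?T \<subseteq> ?I"
  proof
    fix k' assume "k' \<in> int ` ?T"
    then obtain k s where k: "k' = int k" "s \<in> grid_interval N x p k" "touches \<epsilon> a s" by auto
    then have "x 0 + real k * d \<le> \<epsilon> * (of_int a + 1)" "\<epsilon> * of_int a \<le> x 0 + (real k + 1) * d"
      by (auto simp: grid_interval_def touches_def simp flip: d_def)
    then show "k' \<in> ?I" using d by (simp add: k(1) field_simps)
  qed
  have fin: "finite (int ` ?T)" using sub finite_card_int_interval(1) by (rule finite_subset)
  then show "finite ?T" by (simp add: finite_image_iff)
  have "real (card ?T) = real (card (int ` ?T))" by (simp add: card_image)
  also have "\<dots> \<le> real (card ?I)"
    using sub finite_card_int_interval(1) by (simp add: card_mono)
  also have "\<dots> \<le> ?v - ?u + 1"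
    using \<epsilon> d by (intro finite_card_int_interval(2)) (simp add: field_simps)
  also have "?v - ?u + 1 = \<epsilon> / d + 2" by (simp add: diff_divide_distrib add_divide_distrib algebra_simps)
  also have "\<dots> \<le> 3" using d by simp
  finally show "card ?T \<le> 3" by simp
qed

context affine_surface
begin

definition corners_over :: "real \<Rightarrow> word \<Rightarrow> (int \<times> int \<times> int) set" where
  "corners_over \<epsilon> w = cube_corners \<epsilon> (surface_graph (cyl w) f)"

lemma mem_corners_over:
  "(a, b, c) \<in> corners_over \<epsilon> w \<longleftrightarrow>
   (\<exists>t\<in>cyl w. touches \<epsilon> a (fst t) \<and> touches \<epsilon> b (snd t) \<and> touches \<epsilon> c (f t))"
  by (force simp: corners_over_def cube_corners_def surface_graph_def)

lemma cube_corners_graph: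
  "cube_corners \<epsilon> (surface_graph R f) = (\<Union>w\<in>words N p. corners_over \<epsilon> w)"
proof -
  have R: "(\<Union>w\<in>words N p. cyl w) = R"
    using rect_covered_by_cylinders[of p] cyl_subset_rect by (auto simp: words_def)
  have "surface_graph (\<Union>w\<in>words N p. cyl w) f = (\<Union>w\<in>words N p. surface_graph (cyl w) f)"
    by (auto simp: surface_graph_def)
  then have "surface_graph R f = (\<Union>w\<in>words N p. surface_graph (cyl w) f)" by (simp only: R)
  then show ?thesis by (auto simp: corners_over_def cube_corners_def)
qed

text \<open>
  Over a cell of side at most \<open>\<epsilon>\<close> at most 3 mesh intervals are met in each horizontal direction, and
  vertically the values stay within \<open>osc f\<close> of the value at one point, on both sides.
\<close>
lemma corners_over_upper:
  assumes \<epsilon>: "0 < \<epsilon>" and w: "w \<in> words N p"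
  shows "finite (corners_over \<epsilon> w)"
    and "side / real N ^ p \<le> \<epsilon> \<Longrightarrow> real (card (corners_over \<epsilon> w)) \<le> 18 * (osc f (cyl w) / \<epsilon> + 1)"
proof -
  have w': "set w \<subseteq> letters N" "length w = p" using w by (auto simp: words_def)
  define d where "d = side / real N ^ p"
  have d: "0 \<le> d" using side_pos by (simp add: d_def)
  define u v where "u = x 0 + real (fold_index N (map fst w)) * d"
    and "v = y 0 + real (fold_index N (map snd w)) * d"
  have uv: "u \<le> fst t \<and> fst t \<le> u + d \<and> v \<le> snd t \<and> snd t \<le> v + d" if "t \<in> cyl w" for t
    using cyl_grid_interval[OF w'(1) that]
    unfolding grid_interval_def w'(2) square[symmetric] side_def[symmetric] d_def[symmetric] u_def v_def
    by (simp add: algebra_simps)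
  obtain t0 where t0: "t0 \<in> cyl w" using cyl_ne by blast
  define r where "r = osc f (cyl w)"
  have r: "0 \<le> r" using osc_nonneg[OF w'(1)] by (simp add: r_def)
  have f_near: "f t0 - r \<le> f t \<and> f t \<le> f t0 + r" if "t \<in> cyl w" for t
    using diff_le_osc[OF cyl_subset_rect[OF w'(1)] t0 that] diff_le_osc[OF cyl_subset_rect[OF w'(1)] that t0]
    unfolding r_def by linarith
  let ?A = "{a. \<exists>s. u \<le> s \<and> s \<le> u + d \<and> touches \<epsilon> a s}"
  let ?B = "{a. \<exists>s. v \<le> s \<and> s \<le> v + d \<and> touches \<epsilon> a s}"
  let ?C = "{a. \<exists>s. f t0 - r \<le> s \<and> s \<le> f t0 + r \<and> touches \<epsilon> a s}"
  have fin: "finite ?A" "finite ?B" "finite ?C"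
    using d r by (intro touching_cells(1)[OF \<epsilon>]; simp)+
  have sub: "corners_over \<epsilon> w \<subseteq> ?A \<times> ?B \<times> ?C"
    using uv f_near by (auto simp: mem_corners_over) blast+
  show "finite (corners_over \<epsilon> w)" using sub fin by (meson finite_SigmaI finite_subset)
  assume "side / real N ^ p \<le> \<epsilon>"
  then have "d \<le> \<epsilon>" by (simp add: d_def)
  then have "d / \<epsilon> \<le> 1" using \<epsilon> by simp
  then have AB: "real (card ?A) \<le> 3" "real (card ?B) \<le> 3"
    using touching_cells(2)[OF \<epsilon>, of u "u + d"] touching_cells(2)[OF \<epsilon>, of v "v + d"] d by auto
  have C: "real (card ?C) \<le> 2 * (r / \<epsilon> + 1)"
    using touching_cells(2)[OF \<epsilon>, of "f t0 - r" "f t0 + r"] r by simp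
  have "real (card (corners_over \<epsilon> w)) \<le> real (card (?A \<times> ?B \<times> ?C))"
    by (intro of_nat_mono card_mono finite_cartesian_product sub fin)
  also have "\<dots> = real (card ?A) * (real (card ?B) * real (card ?C))"
    by (simp add: card_cartesian_product)
  also have "\<dots> \<le> 3 * (3 * (2 * (r / \<epsilon> + 1)))"
    using AB C by (intro mult_mono) auto
  finally show "real (card (corners_over \<epsilon> w)) \<le> 18 * (osc f (cyl w) / \<epsilon> + 1)"
    by (simp add: r_def)
qed

lemma card_grid_cubes_upper:
  assumes \<epsilon>: "0 < \<epsilon>" and p: "side / real N ^ p \<le> \<epsilon>"
  shows "real (card (grid_cubes \<epsilon> (surface_graph R f)))
    \<le> 18 * (osc_sum N x y f p / \<epsilon> + real N ^ (2 * p))"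
proof -
  have "card (cube_corners \<epsilon> (surface_graph R f)) \<le> (\<Sum>w\<in>words N p. card (corners_over \<epsilon> w))"
    unfolding cube_corners_graph[of _ p] by (intro card_UN_le) simp
  then have "real (card (cube_corners \<epsilon> (surface_graph R f))) \<le> (\<Sum>w\<in>words N p. real (card (corners_over \<epsilon> w)))"
    by (metis of_nat_le_iff of_nat_sum)
  also have "\<dots> \<le> (\<Sum>w\<in>words N p. 18 * (osc f (cyl w) / \<epsilon> + 1))"
    using corners_over_upper(2)[OF \<epsilon> _ p] by (intro sum_mono)
  also have "\<dots> = 18 * (osc_sum N x y f p / \<epsilon> + real N ^ (2 * p))"
    by (simp add: osc_sum_def sum.distrib sum_distrib_left sum_divide_distrib card_words)
  finally show ?thesis by (simp add: card_grid_cubes_eq[OF \<epsilon>])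
qed

lemma touches_floor: "0 < \<epsilon> \<Longrightarrow> touches \<epsilon> \<lfloor>s / \<epsilon>\<rfloor> s"
  unfolding touches_def
  using floor_divide_lower[of \<epsilon> s] floor_divide_upper[of \<epsilon> s] by (simp add: mult.commute less_imp_le)

text \<open>
  The cylinder is connected, so \<open>f\<close> takes all values between any two of its values there, and a
  vertical range of length \<open>r\<close> needs at least \<open>r / \<epsilon>\<close> mesh intervals.
\<close>
lemma corners_over_lower:
  assumes \<epsilon>: "0 < \<epsilon>" and w: "set w \<subseteq> letters N"
  shows "osc f (cyl w) / \<epsilon> \<le> real (card (corners_over \<epsilon> w))"
    and "1 \<le> real (card (corners_over \<epsilon> w))"
proof -
  have fin: "finite (corners_over \<epsilon> w)"
    using corners_over_upper(1)[OF \<epsilon>, of w "length w"] w by (simp add: words_def)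
  let ?C = "(\<lambda>(a, b, c). c) ` corners_over \<epsilon> w"
  have C: "c \<in> ?C" if "t \<in> cyl w" "touches \<epsilon> c (f t)" for c t
  proof -
    have "(\<lfloor>fst t / \<epsilon>\<rfloor>, \<lfloor>snd t / \<epsilon>\<rfloor>, c) \<in> corners_over \<epsilon> w"
      using that touches_floor[OF \<epsilon>] by (auto simp: mem_corners_over)
    then show ?thesis by (rule rev_image_eqI) simp
  qed
  have "f s - f t \<le> \<epsilon> * real (card (corners_over \<epsilon> w))" if st: "s \<in> cyl w" "t \<in> cyl w" for s t
  proof (cases "f t \<le> f s")
    case True
    have "connected (f ` cyl w)"
      by (rule connected_continuous_image[OF continuous_on_subset[OF f_cont cyl_subset_rect[OF w]]
            connected_cyl[OF w]])
    have "{\<lfloor>f t / \<epsilon>\<rfloor>..\<lfloor>f s / \<epsilon>\<rfloor>} \<subseteq> ?C"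
    proof
      fix c assume c: "c \<in> {\<lfloor>f t / \<epsilon>\<rfloor>..\<lfloor>f s / \<epsilon>\<rfloor>}"
      show "c \<in> ?C"
      proof (cases "c = \<lfloor>f t / \<epsilon>\<rfloor>")
        case True
        then show ?thesis using C[OF st(2)] touches_floor[OF \<epsilon>] by simp
      next
        case False
        then have "\<lfloor>f t / \<epsilon>\<rfloor> < c" "c \<le> \<lfloor>f s / \<epsilon>\<rfloor>" using c by auto
        then have "f t / \<epsilon> < of_int c" "of_int c \<le> f s / \<epsilon>"
          by (simp_all only: floor_less_iff le_floor_iff)
        then have "f t \<le> \<epsilon> * of_int c" "\<epsilon> * of_int c \<le> f s"
          using \<epsilon> by (simp_all add: field_simps)
        then have "\<epsilon> * of_int c \<in> f ` cyl w"
          using connectedD_interval[OF \<open>connected (f ` cyl w)\<close>, of "f t" "f s"] st by blast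
        then obtain t' where "t' \<in> cyl w" "f t' = \<epsilon> * of_int c" by auto
        then show ?thesis using \<epsilon> by (intro C[of t']) (auto simp: touches_def)
      qed
    qed
    then have "card {\<lfloor>f t / \<epsilon>\<rfloor>..\<lfloor>f s / \<epsilon>\<rfloor>} \<le> card ?C" using fin by (intro card_mono) auto
    also have "\<dots> \<le> card (corners_over \<epsilon> w)" using fin by (rule card_image_le)
    finally have "nat (\<lfloor>f s / \<epsilon>\<rfloor> - \<lfloor>f t / \<epsilon>\<rfloor> + 1) \<le> card (corners_over \<epsilon> w)" by simp
    then have "f s / \<epsilon> - f t / \<epsilon> \<le> real (card (corners_over \<epsilon> w))" by linarith
    then show ?thesis using \<epsilon> by (simp add: field_simps)
  next
    case False
    moreover have "0 \<le> \<epsilon> * real (card (corners_over \<epsilon> w))" using \<epsilon> by simp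
    ultimately show ?thesis by linarith
  qed
  then have "osc f (cyl w) \<le> \<epsilon> * real (card (corners_over \<epsilon> w))" by (intro osc_le cyl_ne)
  then show "osc f (cyl w) / \<epsilon> \<le> real (card (corners_over \<epsilon> w))"
    using \<epsilon> by (simp add: pos_divide_le_eq mult.commute)
  obtain t where "t \<in> cyl w" using cyl_ne by blast
  then have "?C \<noteq> {}" using C[of t] touches_floor[OF \<epsilon>] by blast
  then have "card (corners_over \<epsilon> w) \<noteq> 0" using fin by auto
  then show "1 \<le> real (card (corners_over \<epsilon> w))" by linarith
qed

text \<open>
  A cube of side at most that of the cells meets at most 3 cells in each of the two directions.
\<close>
lemma card_words_touching:
  assumes \<epsilon>: "0 < \<epsilon>" and p: "\<epsilon> \<le> side / real N ^ p"
  shows "card {w \<in> words N p. k \<in> corners_over \<epsilon> w} \<le> 9"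
proof -
  obtain a b c where k: "k = (a, b, c)" by (metis prod_cases3)
  let ?A = "{j. \<exists>s\<in>grid_interval N x p j. touches \<epsilon> a s}"
  let ?B = "{j. \<exists>s\<in>grid_interval N y p j. touches \<epsilon> b s}"
  let ?W = "{w \<in> words N p. k \<in> corners_over \<epsilon> w}"
  let ?h = "\<lambda>w. (fold_index N (map fst w), fold_index N (map snd w))"
  have A: "finite ?A" "card ?A \<le> 3" and B: "finite ?B" "card ?B \<le> 3"
    using grid_intervals_touched[OF \<epsilon>, of x N p] grid_intervals_touched[OF \<epsilon>, of y N p] p square
    by (simp_all add: side_def)
  have inj: "inj_on ?h ?W"
  proof (rule inj_onI)
    fix w w' assume "w \<in> ?W" "w' \<in> ?W" and eq: "?h w = ?h w'"
    then have w: "length w = length w'" "set w \<subseteq> letters N" "set w' \<subseteq> letters N"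
      by (auto simp: words_def)
    have "map fst w = map fst w'"
      by (rule fold_index_inj[of _ N]) (use w eq in \<open>force simp: letters_def\<close>)+
    moreover have "map snd w = map snd w'"
      by (rule fold_index_inj[of _ N]) (use w eq in \<open>force simp: letters_def\<close>)+
    ultimately show "w = w'" by (rule pair_list_eqI)
  qed
  have sub: "?h ` ?W \<subseteq> ?A \<times> ?B"
  proof
    fix z assume "z \<in> ?h ` ?W"
    then obtain w where w: "w \<in> words N p" "k \<in> corners_over \<epsilon> w" "z = ?h w" by blast
    then obtain t where t: "t \<in> cyl w" "touches \<epsilon> a (fst t)" "touches \<epsilon> b (snd t)"
      by (auto simp: k mem_corners_over)
    then show "z \<in> ?A \<times> ?B"
      using cyl_grid_interval[of w t] w by (auto simp: words_def)
  qed
  have "card ?W = card (?h ` ?W)" by (rule card_image[OF inj, symmetric])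
  also have "\<dots> \<le> card (?A \<times> ?B)"
    by (rule card_mono[OF finite_cartesian_product[OF A(1) B(1)] sub])
  also have "\<dots> \<le> 3 * 3"
    unfolding card_cartesian_product by (rule mult_le_mono[OF A(2) B(2)])
  finally show ?thesis by simp
qed

lemma sum_card_corners_over_le:
  assumes \<epsilon>: "0 < \<epsilon>" and p: "\<epsilon> \<le> side / real N ^ p"
  shows "(\<Sum>w\<in>words N p. real (card (corners_over \<epsilon> w)))
    \<le> 9 * real (card (grid_cubes \<epsilon> (surface_graph R f)))"
proof -
  let ?T = "cube_corners \<epsilon> (surface_graph R f)"
  have T: "?T = (\<Union>w\<in>words N p. corners_over \<epsilon> w)" by (rule cube_corners_graph)
  have fin: "finite ?T" unfolding T using corners_over_upper(1)[OF \<epsilon>] by auto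
  have "(\<Sum>w\<in>words N p. card (corners_over \<epsilon> w)) = (\<Sum>w\<in>words N p. \<Sum>k\<in>?T. if k \<in> corners_over \<epsilon> w then 1 else 0)"
  proof (rule sum.cong)
    fix w assume "w \<in> words N p"
    then have "?T \<inter> corners_over \<epsilon> w = corners_over \<epsilon> w" unfolding T by auto
    then show "card (corners_over \<epsilon> w) = (\<Sum>k\<in>?T. if k \<in> corners_over \<epsilon> w then 1 else 0)"
      using fin by (simp add: sum.If_cases)
  qed simp
  also have "\<dots> = (\<Sum>k\<in>?T. \<Sum>w\<in>words N p. if k \<in> corners_over \<epsilon> w then 1 else 0)"
    by (rule sum.swap)
  also have "\<dots> = (\<Sum>k\<in>?T. card {w \<in> words N p. k \<in> corners_over \<epsilon> w})"
    by (simp add: sum.If_cases Int_def)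
  also have "\<dots> \<le> (\<Sum>k\<in>?T. 9)"
    using card_words_touching[OF \<epsilon> p] by (intro sum_mono)
  finally have "(\<Sum>w\<in>words N p. card (corners_over \<epsilon> w)) \<le> 9 * card ?T" by simp
  then have "real (\<Sum>w\<in>words N p. card (corners_over \<epsilon> w)) \<le> real (9 * card ?T)"
    by (simp only: of_nat_le_iff)
  then show ?thesis by (simp add: card_grid_cubes_eq[OF \<epsilon>])
qed

lemma card_grid_cubes_lower:
  assumes \<epsilon>: "0 < \<epsilon>" and p: "\<epsilon> \<le> side / real N ^ p"
  shows "osc_sum N x y f p / \<epsilon> + real N ^ (2 * p)
    \<le> 18 * real (card (grid_cubes \<epsilon> (surface_graph R f)))"
proof -
  have "osc_sum N x y f p / \<epsilon> = (\<Sum>w\<in>words N p. osc f (cyl w) / \<epsilon>)"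
    by (simp add: osc_sum_def sum_divide_distrib)
  also have "\<dots> \<le> (\<Sum>w\<in>words N p. real (card (corners_over \<epsilon> w)))"
    using corners_over_lower(1)[OF \<epsilon>] by (intro sum_mono) (auto simp: words_def)
  also note sum_card_corners_over_le[OF assms]
  finally have 1: "osc_sum N x y f p / \<epsilon> \<le> 9 * real (card (grid_cubes \<epsilon> (surface_graph R f)))" .
  have "real N ^ (2 * p) = (\<Sum>w\<in>words N p. 1)" by (simp add: card_words)
  also have "\<dots> \<le> (\<Sum>w\<in>words N p. real (card (corners_over \<epsilon> w)))"
    using corners_over_lower(2)[OF \<epsilon>] by (intro sum_mono) (auto simp: words_def)
  also note sum_card_corners_over_le[OF assms]
  finally have "real N ^ (2 * p) \<le> 9 * real (card (grid_cubes \<epsilon> (surface_graph R f)))" .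
  with 1 show ?thesis by linarith
qed

lemma mesh_level:
  assumes "0 < \<epsilon>" "\<epsilon> \<le> side"
  obtains p where "side / real N ^ Suc p < \<epsilon>" "\<epsilon> \<le> side / real N ^ p"
proof -
  have "\<exists>n. side / real N ^ n < \<epsilon>"
  proof -
    obtain n where "side / \<epsilon> < real N ^ n" using real_arch_pow[of "real N"] N2 by auto
    then show ?thesis using assms N0 by (auto simp: field_simps)
  qed
  then obtain n where n: "side / real N ^ n < \<epsilon>" "\<And>m. m < n \<Longrightarrow> \<not> side / real N ^ m < \<epsilon>"
    using exists_least_iff[of "\<lambda>n. side / real N ^ n < \<epsilon>"] by blast
  have "n \<noteq> 0" using n(1) assms(2) by (intro notI) simp
  then obtain p where "n = Suc p" by (cases n) auto
  then show thesis using n by (intro that[of p]) (auto simp: not_less)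
qed

lemma power_eq_powr:
  assumes "0 < \<tau>"
  shows "(real N * \<tau>) ^ p = (real N ^ p) powr (1 + log N \<tau>)"
proof -
  have "real N powr (1 + log N \<tau>) = real N * \<tau>"
    using N2 assms by (simp add: powr_add)
  moreover have "(real N ^ p) powr (1 + log N \<tau>) = (real N powr (1 + log N \<tau>)) ^ p"
    using N0 by (simp add: powr_realpow[symmetric] powr_powr mult.commute)
  ultimately show ?thesis by simp
qed

text \<open>
  With \<open>N ^ p\<close> comparable to \<open>1 / \<epsilon>\<close> the number of cubes is at most of the order of
  \<open>N ^ p * osc_sum p + N ^ (2 * p)\<close>, hence of \<open>(N * \<tau>) ^ p\<close>, and \<open>N * \<tau>\<close> is \<open>N\<close> to the
  power \<open>1 + log N \<tau>\<close>. The lower estimate below is the mirror image.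
\<close>
lemma card_grid_cubes_le_powr:
  assumes \<tau>: "real N \<le> \<tau>" and C: "\<And>p. osc_sum N x y f p \<le> C * \<tau> ^ p"
  shows "\<exists>C'. \<forall>\<^sub>F \<epsilon> in at_right 0.
    real (card (grid_cubes \<epsilon> (surface_graph R f))) \<le> C' * (1 / \<epsilon>) powr (1 + log N \<tau>)"
proof -
  let ?n = "\<lambda>\<epsilon>. real (card (grid_cubes \<epsilon> (surface_graph R f)))"
  let ?s = "1 + log N \<tau>"
  have \<tau>0: "0 < \<tau>" using \<tau> N0 by linarith
  have C0: "0 \<le> C" using C[of 0] osc_sum_nonneg[of 0] by simp
  have s: "0 \<le> ?s"
    using N2 \<tau> by (intro add_nonneg_nonneg zero_le_log_cancel_iff[THEN iffD2]) auto
  let ?D = "18 * (C / side + 1) * (real N * \<tau>) * side powr ?s"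
  have "?n \<epsilon> \<le> ?D * (1 / \<epsilon>) powr ?s" if \<epsilon>: "0 < \<epsilon>" "\<epsilon> < side" for \<epsilon>
  proof -
    obtain p where p: "side / real N ^ Suc p < \<epsilon>" "\<epsilon> \<le> side / real N ^ p"
      using mesh_level[of \<epsilon>] \<epsilon> by auto
    have "1 / \<epsilon> \<le> real N ^ Suc p / side"
      using p(1) \<epsilon>(1) side_pos N0 by (simp add: field_simps)
    then have "osc_sum N x y f (Suc p) / \<epsilon> \<le> osc_sum N x y f (Suc p) * (real N ^ Suc p / side)"
      using osc_sum_nonneg[of "Suc p"] mult_left_mono by fastforce
    also have "\<dots> \<le> (C * \<tau> ^ Suc p) * (real N ^ Suc p / side)"
      using C[of "Suc p"] side_pos by (intro mult_right_mono) auto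
    also have "\<dots> = C / side * (real N * \<tau>) ^ Suc p"
      unfolding power_mult_distrib by simp
    finally have 1: "osc_sum N x y f (Suc p) / \<epsilon> \<le> C / side * (real N * \<tau>) ^ Suc p" .
    have 2: "real N ^ (2 * Suc p) \<le> (real N * \<tau>) ^ Suc p"
      unfolding power_mult using \<tau> by (intro power_mono) (auto simp: power2_eq_square intro: mult_left_mono)
    have "?n \<epsilon> \<le> 18 * (osc_sum N x y f (Suc p) / \<epsilon> + real N ^ (2 * Suc p))"
      using card_grid_cubes_upper[OF \<epsilon>(1), of "Suc p"] p(1) by simp
    also have "\<dots> \<le> 18 * (C / side * (real N * \<tau>) ^ Suc p + (real N * \<tau>) ^ Suc p)"
      by (intro mult_left_mono add_mono 1 2) simp
    also have "\<dots> = 18 * (C / side + 1) * (real N * \<tau>) * (real N * \<tau>) ^ p"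
      by (simp add: algebra_simps)
    also have "(real N * \<tau>) ^ p \<le> side powr ?s * (1 / \<epsilon>) powr ?s"
    proof -
      have "real N ^ p \<le> side * (1 / \<epsilon>)" using p(2) \<epsilon>(1) N0 by (simp add: field_simps)
      then have "(real N ^ p) powr ?s \<le> (side * (1 / \<epsilon>)) powr ?s" using s by (intro powr_mono2) auto
      also have "\<dots> = side powr ?s * (1 / \<epsilon>) powr ?s"
        using side_pos \<epsilon>(1) by (intro powr_mult)
      finally show ?thesis by (simp only: power_eq_powr[OF \<tau>0])
    qed
    then have "18 * (C / side + 1) * (real N * \<tau>) * (real N * \<tau>) ^ p
        \<le> 18 * (C / side + 1) * (real N * \<tau>) * (side powr ?s * (1 / \<epsilon>) powr ?s)"
      using C0 side_pos \<tau>0 by (intro mult_left_mono) auto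
    finally show ?thesis by (simp only: mult.assoc)
  qed
  then have "\<forall>\<^sub>F \<epsilon> in at_right 0. ?n \<epsilon> \<le> ?D * (1 / \<epsilon>) powr ?s"
    using side_pos by (auto simp: eventually_at_right_field)
  then show ?thesis by blast
qed

lemma powr_le_card_grid_cubes:
  assumes \<tau>: "1 \<le> \<tau>" and c: "0 < c"
    and ge: "\<And>p. p0 \<le> p \<Longrightarrow> c * \<tau> ^ p \<le> osc_sum N x y f p + real N ^ p"
  shows "\<exists>c'>0. \<forall>\<^sub>F \<epsilon> in at_right 0.
    c' * (1 / \<epsilon>) powr (1 + log N \<tau>) \<le> real (card (grid_cubes \<epsilon> (surface_graph R f)))"
proof -
  let ?n = "\<lambda>\<epsilon>. real (card (grid_cubes \<epsilon> (surface_graph R f)))"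
  let ?s = "1 + log N \<tau>"
  have \<tau>0: "0 < \<tau>" using \<tau> by linarith
  have s: "0 \<le> ?s"
    using N2 \<tau> by (intro add_nonneg_nonneg zero_le_log_cancel_iff[THEN iffD2]) auto
  define b where "b = min (1 / side) 1"
  have b: "0 < b" "b \<le> 1 / side" "b \<le> 1" using side_pos by (auto simp: b_def)
  let ?D = "(b * c / (18 * (real N * \<tau>))) * side powr ?s"
  have "?D * (1 / \<epsilon>) powr ?s \<le> ?n \<epsilon>" if \<epsilon>: "0 < \<epsilon>" "\<epsilon> < side / real N ^ p0" for \<epsilon>
  proof -
    have "side / real N ^ p0 \<le> side / 1"
      using side_pos N0 by (intro divide_left_mono) auto
    then have "\<epsilon> \<le> side" using \<epsilon>(2) by simp
    then obtain p where p: "side / real N ^ Suc p < \<epsilon>" "\<epsilon> \<le> side / real N ^ p"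
      using mesh_level[of \<epsilon>] \<epsilon>(1) by auto
    have "p0 \<le> p"
    proof (rule ccontr)
      assume "\<not> p0 \<le> p"
      then have "real N ^ Suc p \<le> real N ^ p0" using N0 by (intro power_increasing) auto
      then have "side / real N ^ p0 \<le> side / real N ^ Suc p"
        using side_pos N0 by (intro divide_left_mono) auto
      then show False using p(1) \<epsilon>(2) by linarith
    qed
    note ge = ge[OF this]
    have "b * real N ^ p \<le> 1 / side * real N ^ p" using b(2) by (intro mult_right_mono) auto
    also have "\<dots> \<le> 1 / \<epsilon>"
      using p(2) \<epsilon>(1) side_pos N0 by (simp add: field_simps)
    finally have "osc_sum N x y f p * (b * real N ^ p) \<le> osc_sum N x y f p * (1 / \<epsilon>)"
      by (intro mult_left_mono osc_sum_nonneg)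
    moreover have "real N ^ p * (b * real N ^ p) \<le> real N ^ (2 * p)"
    proof -
      have "b * (real N ^ p * real N ^ p) \<le> 1 * (real N ^ p * real N ^ p)"
        using b(3) by (intro mult_right_mono) auto
      then show ?thesis unfolding mult_2 power_add by (simp only: mult.left_commute mult_1)
    qed
    ultimately have "(osc_sum N x y f p + real N ^ p) * (b * real N ^ p)
        \<le> osc_sum N x y f p / \<epsilon> + real N ^ (2 * p)" by (simp add: distrib_right)
    also have "\<dots> \<le> 18 * ?n \<epsilon>" by (rule card_grid_cubes_lower[OF \<epsilon>(1) p(2)])
    finally have "(osc_sum N x y f p + real N ^ p) * (b * real N ^ p) \<le> 18 * ?n \<epsilon>" .
    moreover have "(c * \<tau> ^ p) * (b * real N ^ p) \<le> (osc_sum N x y f p + real N ^ p) * (b * real N ^ p)"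
      using b(1) by (intro mult_right_mono ge) simp
    ultimately have "(c * \<tau> ^ p) * (b * real N ^ p) \<le> 18 * ?n \<epsilon>" by linarith
    then have "b * c * (real N * \<tau>) ^ p \<le> 18 * ?n \<epsilon>" by (simp add: power_mult_distrib mult_ac)
    moreover have "side powr ?s * (1 / \<epsilon>) powr ?s \<le> (real N * \<tau>) ^ Suc p"
    proof -
      have "side * (1 / \<epsilon>) \<le> real N ^ Suc p" using p(1) \<epsilon>(1) N0 by (simp add: field_simps)
      then have "(side * (1 / \<epsilon>)) powr ?s \<le> (real N ^ Suc p) powr ?s"
        using s side_pos \<epsilon>(1) by (intro powr_mono2) auto
      moreover have "(side * (1 / \<epsilon>)) powr ?s = side powr ?s * (1 / \<epsilon>) powr ?s"
        using side_pos \<epsilon>(1) by (intro powr_mult)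
      ultimately show ?thesis by (simp only: power_eq_powr[OF \<tau>0])
    qed
    then have "(b * c / (18 * (real N * \<tau>))) * (side powr ?s * (1 / \<epsilon>) powr ?s)
        \<le> (b * c / (18 * (real N * \<tau>))) * (real N * \<tau>) ^ Suc p"
      using b(1) c \<tau>0 by (intro mult_left_mono) auto
    moreover have "(b * c / (18 * (real N * \<tau>))) * (real N * \<tau>) ^ Suc p = b * c * (real N * \<tau>) ^ p / 18"
      using \<tau>0 N0 by simp
    ultimately show ?thesis unfolding mult.assoc[of _ "side powr ?s"] by linarith
  qed
  moreover have "0 < side / real N ^ p0" using side_pos N0 by simp
  ultimately have "\<forall>\<^sub>F \<epsilon> in at_right 0. ?D * (1 / \<epsilon>) powr ?s \<le> ?n \<epsilon>"
    by (auto simp: eventually_at_right_field)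
  moreover have "0 < ?D" using b(1) c \<tau>0 N0 side_pos by simp
  ultimately show ?thesis by blast
qed

lemma log_powr_minus_1: "1 + log N (real N powr (s - 1)) = s"
  using N2 by simp

text \<open>
  The summand \<open>N ^ (2 * p)\<close> of the cube count, which comes from the base square, yields the lower
  estimate for exponents up to 2, and growth of the oscillation sums yields it between 2 and
  \<open>1 + log N r\<close>. The second range is empty for \<open>r = N\<close>, which is how dimension 2 arises.
\<close>
lemma has_box_dim_surface:
  assumes r: "real N \<le> r"
    and upper: "\<And>\<tau>. r < \<tau> \<Longrightarrow> \<exists>C. \<forall>p. osc_sum N x y f p \<le> C * \<tau> ^ p"
    and lower: "\<And>\<tau>. real N < \<tau> \<Longrightarrow> \<tau> < r \<Longrightarrow> \<exists>c>0. \<exists>p0. \<forall>p\<ge>p0. c * \<tau> ^ p \<le> osc_sum N x y f p"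
  shows "has_box_dim (surface_graph R f) (1 + ln r / ln (real N))"
proof -
  have r0: "0 < r" using r N0 by linarith
  have d: "1 + ln r / ln (real N) = 1 + log N r" by (simp add: log_def)
  have r_powr: "r = real N powr log N r" using N2 r0 by simp
  show ?thesis unfolding d
  proof (rule has_box_dimI[where ?s0.0 = 1])
    fix s assume s: "1 + log N r < s"
    define \<tau> where "\<tau> = real N powr (s - 1)"
    have "r < \<tau>" using s N2 unfolding \<tau>_def by (subst r_powr) (intro powr_less_mono, auto)
    then obtain C where "\<And>p. osc_sum N x y f p \<le> C * \<tau> ^ p" using upper by blast
    then show "\<exists>C. \<forall>\<^sub>F \<epsilon> in at_right 0.
        real (card (grid_cubes \<epsilon> (surface_graph R f))) \<le> C * (1 / \<epsilon>) powr s"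
      using card_grid_cubes_le_powr[of \<tau> C] \<open>r < \<tau>\<close> r log_powr_minus_1[of s] by (simp add: \<tau>_def)
  next
    show "1 < 1 + log N r" using N2 r by simp
  next
    fix s assume s: "1 < s" "s < 1 + log N r"
    define \<tau> where "\<tau> = real N powr (s - 1)"
    have "\<tau> < r" using s N2 unfolding \<tau>_def by (subst r_powr) (intro powr_less_mono, auto)
    have \<tau>1: "1 \<le> \<tau>" unfolding \<tau>_def using s N2 by (intro ge_one_powr_ge_zero) auto
    have "\<exists>c>0. \<exists>p0. \<forall>p\<ge>p0. c * \<tau> ^ p \<le> osc_sum N x y f p + real N ^ p"
    proof (cases "\<tau> \<le> real N")
      case True
      have "1 * \<tau> ^ p \<le> osc_sum N x y f p + real N ^ p" for p
        using power_mono[OF True, of p] \<tau>1 osc_sum_nonneg[of p] by simp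
      then show ?thesis by (intro exI[of _ 1]) auto
    next
      case False
      then obtain c p0 where c: "0 < c" "\<And>p. p0 \<le> p \<Longrightarrow> c * \<tau> ^ p \<le> osc_sum N x y f p"
        using lower[OF _ \<open>\<tau> < r\<close>] by auto
      have "c * \<tau> ^ p \<le> osc_sum N x y f p + real N ^ p" if "p0 \<le> p" for p
        using c(2)[OF that] by (simp add: add_increasing2)
      then show ?thesis using c(1) by blast
    qed
    then obtain c p0 where "0 < c" "\<And>p. p0 \<le> p \<Longrightarrow> c * \<tau> ^ p \<le> osc_sum N x y f p + real N ^ p"
      by blast
    from powr_le_card_grid_cubes[OF \<tau>1 this]
    show "\<exists>c>0. \<forall>\<^sub>F \<epsilon> in at_right 0.
        c * (1 / \<epsilon>) powr s \<le> real (card (grid_cubes \<epsilon> (surface_graph R f)))"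
      unfolding \<tau>_def log_powr_minus_1 .
  qed
qed

text \<open>
  If the growth rate exceeds \<open>N\<close> but \<open>osc_sum p / N ^ p\<close> stays bounded, or if the growth rate is at most
  \<open>N\<close>, then the oscillation sums grow no faster than \<open>\<tau> ^ p\<close> for every \<open>\<tau> > N\<close>; in the remaining case
  their exponential rate is the growth rate.
\<close>
lemma box_dim_dichotomy:
  "if growth_rate > real N \<and> limsup (\<lambda>p. ereal (osc_sum N x y f p / real N ^ p)) = \<infinity>
   then has_box_dim (surface_graph R f) (1 + ln growth_rate / ln (real N))
   else has_box_dim (surface_graph R f) 2"
proof (cases "growth_rate > real N \<and> limsup (\<lambda>p. ereal (osc_sum N x y f p / real N ^ p)) = \<infinity>")
  case True
  have unbounded: "\<exists>p. T * real N ^ p < osc_sum N x y f p" for T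
  proof (rule ccontr)
    assume "\<nexists>p. T * real N ^ p < osc_sum N x y f p"
    then have "osc_sum N x y f p / real N ^ p \<le> T" for p
      using N0 by (simp add: pos_divide_le_eq not_less)
    then have "limsup (\<lambda>p. ereal (osc_sum N x y f p / real N ^ p)) \<le> ereal T"
      by (intro Limsup_bounded always_eventually) simp
    then show False using True by simp
  qed
  have "has_box_dim (surface_graph R f) (1 + ln growth_rate / ln (real N))"
    using True osc_sum_le_power power_le_osc_sum[OF _ _ unbounded] by (intro has_box_dim_surface) auto
  then show ?thesis using True by simp
next
  case False
  have "\<exists>C. \<forall>p. osc_sum N x y f p \<le> C * \<tau> ^ p" if \<tau>: "real N < \<tau>" for \<tau>
  proof (cases "growth_rate < \<tau>")
    case True
    then show ?thesis using osc_sum_le_power \<tau> by blast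
  next
    case False
    then have "limsup (\<lambda>p. ereal (osc_sum N x y f p / real N ^ p)) \<noteq> \<infinity>"
      using \<open>\<not> (growth_rate > real N \<and> _)\<close> \<tau> by auto
    then obtain T where "limsup (\<lambda>p. ereal (osc_sum N x y f p / real N ^ p)) < ereal T"
      using less_PInf_Ex_of_nat by (metis ereal_infty_less(1))
    then have "\<forall>\<^sub>F p in sequentially. ereal (osc_sum N x y f p / real N ^ p) < ereal T"
      by (rule Limsup_lessD)
    then obtain p0 where p0: "\<And>p. p0 \<le> p \<Longrightarrow> osc_sum N x y f p / real N ^ p < T"
      by (auto simp: eventually_sequentially)
    define C where "C = \<bar>T\<bar> + (\<Sum>p<p0. osc_sum N x y f p / real N ^ p)"
    have C0: "0 \<le> osc_sum N x y f p / real N ^ p" for p using osc_sum_nonneg by simp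
    have sum0: "0 \<le> (\<Sum>p<p0. osc_sum N x y f p / real N ^ p)" by (intro sum_nonneg C0)
    have "osc_sum N x y f p / real N ^ p \<le> C" for p
    proof (cases "p0 \<le> p")
      case True
      then show ?thesis using p0[OF True] sum0 unfolding C_def by linarith
    next
      case False
      then have "osc_sum N x y f p / real N ^ p \<le> (\<Sum>p<p0. osc_sum N x y f p / real N ^ p)"
        using C0 by (intro member_le_sum) auto
      then show ?thesis unfolding C_def by linarith
    qed
    then have le: "osc_sum N x y f p \<le> C * real N ^ p" for p
      using N0 by (simp add: pos_divide_le_eq)
    have "0 \<le> C" unfolding C_def using sum0 by linarith
    then have "C * real N ^ p \<le> C * \<tau> ^ p" for p using \<tau> by (intro mult_left_mono power_mono) auto
    then show ?thesis using le order_trans by blast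
  qed
  then have "has_box_dim (surface_graph R f) (1 + ln (real N) / ln (real N))"
    by (intro has_box_dim_surface) auto
  moreover have "1 + ln (real N) / ln (real N) = 2" using N2 by simp
  ultimately have "has_box_dim (surface_graph R f) 2" by (simp only:)
  then show ?thesis by (simp only: if_not_P[OF False])
qed

end

section \<open>The generalized affine fractal interpolation surface\<close>

theorem theorem4p4:
  fixes N :: nat and x y :: "nat \<Rightarrow> real" and z :: "nat \<Rightarrow> nat \<Rightarrow> real"
    and g h S q f :: "real \<times> real \<Rightarrow> real" and lamS lamq :: real
  defines "D \<equiv> rect N x y"
  assumes N: "N \<ge> 2"
    and x: "uniform_partition N x"
    and y: "uniform_partition N y"
    and square: "x N - x 0 = y N - y 0"
    and g_cont: "continuous_on D g"
    and h_cont: "continuous_on D h"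
    and S_cont: "continuous_on D S"
    and g_interp: "\<And>i j. i \<in> {0, N} \<Longrightarrow> j \<in> {0, N} \<Longrightarrow> g (x i, y j) = z i j"
    and h_interp: "\<And>i j. i \<le> N \<Longrightarrow> j \<le> N \<Longrightarrow> h (x i, y j) = z i j"
    and S_less_1: "\<And>t. t \<in> D \<Longrightarrow> \<bar>S t\<bar> < 1"
    and q_def: "\<And>w t. w \<in> letters N \<Longrightarrow> t \<in> cell x y w \<Longrightarrow>
                  q t = h t - S t * g (inv_into D (L_map N x y w) t)"
    and f_cont: "continuous_on D f"
    and f_interp: "\<And>i j. i \<le> N \<Longrightarrow> j \<le> N \<Longrightarrow> f (x i, y j) = z i j"
    and f_graph: "surface_graph D f =
                  (\<Union>w\<in>letters N. Psi_map N x y S q w ` surface_graph D f)"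
    and S_lipschitz: "lamS > 0" "lamS-lipschitz_on D S"
    and q_lipschitz: "lamq > 0" "lamq-lipschitz_on D q"
    and S_sign: "(\<forall>t\<in>D. S t > 0) \<or> (\<forall>t\<in>D. S t < 0)"
  shows "if rho_S N x y S > real N \<and>
            limsup (\<lambda>p. ereal (osc_sum N x y f p / real N ^ p)) = \<infinity>
         then has_box_dim (surface_graph D f) (1 + ln (rho_S N x y S) / ln (real N))
         else has_box_dim (surface_graph D f) 2"
proof -
  interpret affine_surface N x y S q f lamS lamq
    using N x y square S_less_1 f_cont f_graph S_lipschitz(2) q_lipschitz(2) S_sign
    unfolding D_def by unfold_locales
  show ?thesis unfolding D_def rho_S_eq by (rule box_dim_dichotomy)
qed

end
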